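(* Let $K$ be a finite extension of $\mathbb{Q}_\ell$, let $0<r<1$, and let $\vec f=A\vec x+\hat f(\vec x)$ be an element of $\mathrm{End}^{\mathrm{op}}K^{\leqslant r}\langle\!\langle\vec x\rangle\!\rangle$, where $\hat f=O(x^2)$. Suppose that $\vec f$ is semisimple, that $A$ is a diagonal matrix, and that the eigenvalues $\lambda_1,\dots,\lambda_n$ of $A$ satisfy $\ell$-Siegel's condition with parameters $c,\mu>0$. Suppose $|\lambda_i|\leqslant 1$ for all $i$. Then there exist a radius $0<r_\infty<r$ and an invertible element $\vec\psi\in\mathrm{End}^{\mathrm{op}}K^{\leqslant r_\infty}\langle\!\langle\vec x\rangle\!\rangle$ such that $\vec\psi^{-1}\circ\vec f\circ\vec\psi=A\vec x$.
   Context: $\ell$ is a prime and $|\cdot|$ is the $\ell$-adic absolute value. $K\langle\!\langle\vec x\rangle\!\rangle$ is the ring of noncommutative formal power series over $K$ in $\vec x=(x_1,\dots,x_n)$. For a finite word $I=(i_1,\dots,i_m)$ in $\{1,\dots,n\}$ put $x^I=x_{i_1}\cdots x_{i_m}$ and $|I|=m$. For $0<r<1$, $K^{\leqslant r}\langle\!\langle\vec x\rangle\!\rangle$ is the set of $f=\sum_I a_Ix^I$ with $|a_I|r^{|I|}\to0$ as $|I|\to\infty$, with norm $\|f\|_r=\sup_I|a_I|r^{|I|}$. $\mathscr I$ is the ideal of series in $K^{\leqslant r}\langle\!\langle\vec x\rangle\!\rangle$ with zero constant term, and $f=g+O(x^m)$ means $f-g\in\mathscr I^m$ (componentwise for tuples).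 $\mathrm{End}^{\mathrm{op}}K^{\leqslant r}\langle\!\langle\vec x\rangle\!\rangle$ is the set of $n$-tuples $\vec f=(f_1,\dots,f_n)$ of elements of $K^{\leqslant r}\langle\!\langle\vec x\rangle\!\rangle$ with zero constant term and $\|f_i\|_r\leqslant r$ for all $i$; composition is substitution $\vec f\circ\vec g=(f_1(\vec g),\dots,f_n(\vec g))$, with identity $\vec x$. For $r'<r$ such a tuple is also viewed as an element of $\mathrm{End}^{\mathrm{op}}K^{\leqslant r'}\langle\!\langle\vec x\rangle\!\rangle$. Semisimple: $\vec f$ is semisimple if the operator $P\mapsto P\circ\vec f$ on $K^{\leqslant r}\langle\!\langle\vec x\rangle\!\rangle/\mathscr I^m$ is semisimple for all $m$. $\ell$-Siegel's condition with parameters $c,\mu>0$ for $\lambda_1,\dots,\lambda_n\in\overline{\mathbb{Q}_\ell}$: for any nonnegative integers $i_1,\dots,i_n$ with $i_1+\dots+i_n=N$ and any index $j$ such that $\lambda_1^{i_1}\cdots\lambda_n^{i_n}\neq\lambda_j$, one has $|\lambda_1^{i_1}\cdots\lambda_n^{i_n}-\lambda_j|\geqslant c(N/2)^{-\mu}$ (for $N\ge1$). *)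

theory Defs
  imports "HOL-Analysis.Analysis" "HOL-Library.Set_Algebras"
begin

section \<open>Finite extensions of the field of l-adic numbers\<close>

definition padic_abs :: "nat \<Rightarrow> rat \<Rightarrow> real" where
  "padic_abs l q = (if q = 0 then 0 else
     real l powi (int (multiplicity (int l) (snd (quotient_of q)))
                - int (multiplicity (int l) (fst (quotient_of q)))))"

definition rat_closure :: "('k::field_char_0 \<Rightarrow> real) \<Rightarrow> 'k set" where
  "rat_closure v = {x. \<exists>q :: nat \<Rightarrow> rat. (\<lambda>n. v (x - of_rat (q n))) \<longlonglongrightarrow> 0}"

text \<open>
  The type \<open>'k\<close> is a finite extension of the l-adic numbers, and \<open>v\<close> is its absolute value.
  The subfield of l-adic numbers is given as the completion of the rationals
  for the l-adic absolute value, that is, as a complete subfield in which they are dense. Such a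
  subfield is necessarily the closure of the rationals. The last assumption says that \<open>'k\<close> has
  finite dimension over it.
\<close>

locale finite_extension_padic =
  fixes l :: nat and v :: "'k::field_char_0 \<Rightarrow> real"
  assumes prime_l: "prime l"
    and abs_nonneg: "v x \<ge> 0"
    and abs_eq_0_iff: "v x = 0 \<longleftrightarrow> x = 0"
    and abs_mult: "v (x * y) = v x * v y"
    and abs_ultrametric: "v (x + y) \<le> max (v x) (v y)"
    and abs_of_rat: "v (of_rat q) = padic_abs l q"
    and complete: "\<lbrakk>range s \<subseteq> rat_closure v;
          \<forall>e>0. \<exists>N. \<forall>m\<ge>N. \<forall>n\<ge>N. v (s m - s n) < e\<rbrakk>
        \<Longrightarrow> \<exists>x\<in>rat_closure v. (\<lambda>n. v (s n - x)) \<longlonglongrightarrow> 0"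
    and finite_degree: "\<exists>B. finite B \<and>
          (\<forall>x. \<exists>c. c ` B \<subseteq> rat_closure v \<and> x = (\<Sum>b\<in>B. c b * b))"


section \<open>Noncommutative formal power series\<close>

text \<open>The variables are indexed by a type \<open>'n\<close> and the coefficients by words in \<open>'n\<close>.\<close>

typedef ('n, 'k) ncfps = "UNIV :: ('n list \<Rightarrow> 'k) set"
  morphisms nc_coeff Abs_ncfps ..

setup_lifting type_definition_ncfps

lemma ncfps_eqI: "(\<And>w. nc_coeff f w = nc_coeff g w) \<Longrightarrow> f = g"
  by transfer auto

instantiation ncfps :: (type, ring_1) ring_1
begin

lift_definition zero_ncfps :: "('a, 'b) ncfps" is "\<lambda>_. 0" .
lift_definition one_ncfps :: "('a, 'b) ncfps" is "\<lambda>w. if w = [] then 1 else 0" .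
lift_definition plus_ncfps :: "('a, 'b) ncfps \<Rightarrow> ('a, 'b) ncfps \<Rightarrow> ('a, 'b) ncfps"
  is "\<lambda>f g w. f w + g w" .
lift_definition minus_ncfps :: "('a, 'b) ncfps \<Rightarrow> ('a, 'b) ncfps \<Rightarrow> ('a, 'b) ncfps"
  is "\<lambda>f g w. f w - g w" .
lift_definition uminus_ncfps :: "('a, 'b) ncfps \<Rightarrow> ('a, 'b) ncfps"
  is "\<lambda>f w. - f w" .
lift_definition times_ncfps :: "('a, 'b) ncfps \<Rightarrow> ('a, 'b) ncfps \<Rightarrow> ('a, 'b) ncfps"
  is "\<lambda>f g w. \<Sum>k\<le>length w. f (take k w) * g (drop k w)" .

instance
proof
  fix f g h :: "('a, 'b) ncfps"
  show "f * g * h = f * (g * h)"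
  proof (transfer, rule ext)
    fix f g h :: "'a list \<Rightarrow> 'b" and w :: "'a list"
    let ?n = "length w"
    define t where "t = (\<lambda>j k. f (take j w) * g (drop j (take k w)) * h (drop k w))"
    have "(\<Sum>k\<le>?n. (\<Sum>j\<le>length (take k w). f (take j (take k w)) * g (drop j (take k w)))
            * h (drop k w)) = (\<Sum>k\<le>?n. \<Sum>j\<le>k. t j k)"
      by (rule sum.cong) (auto simp: t_def sum_distrib_right min_absorb1 min_absorb2 intro!: sum.cong)
    also have "\<dots> = (\<Sum>j\<le>?n. \<Sum>k\<in>{j..?n}. t j k)"
      by (subst sum.Sigma, simp, simp, subst sum.Sigma, simp, simp,
          rule sum.reindex_bij_witness[where i = "\<lambda>(j, k). (k, j)" and j = "\<lambda>(k, j). (j, k)"]) auto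
    also have "\<dots> = (\<Sum>j\<le>?n. f (take j w) * (\<Sum>i\<le>length (drop j w).
                    g (take i (drop j w)) * h (drop i (drop j w))))"
    proof (rule sum.cong)
      fix j assume "j \<in> {..?n}"
      then have j: "j \<le> ?n" by simp
      have "(\<Sum>k\<in>{j..?n}. t j k) = (\<Sum>i\<le>?n - j. t j (j + i))"
        by (rule sum.reindex_bij_witness[where i = "\<lambda>i. j + i" and j = "\<lambda>k. k - j"]) (use j in auto)
      also have "\<dots> = f (take j w) * (\<Sum>i\<le>length (drop j w).
                    g (take i (drop j w)) * h (drop i (drop j w)))"
        by (auto simp: t_def sum_distrib_left mult.assoc drop_take add.commute intro!: sum.cong)
      finally show "(\<Sum>k\<in>{j..?n}. t j k) = \<dots>" .
    qed simp
    finally show "(\<Sum>k\<le>?n. (\<Sum>j\<le>length (take k w). f (take j (take k w)) * g (drop j (take k w)))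
            * h (drop k w)) = (\<Sum>j\<le>?n. f (take j w) * (\<Sum>i\<le>length (drop j w).
                    g (take i (drop j w)) * h (drop i (drop j w))))" .
  qed
  show "1 * f = f"
  proof (transfer, rule ext)
    fix f :: "'a list \<Rightarrow> 'b" and w :: "'a list"
    have "(\<Sum>k\<le>length w. (if take k w = [] then 1 else 0) * f (drop k w))
        = (\<Sum>k\<le>length w. if k = 0 then f w else 0)"
      by (rule sum.cong) auto
    then show "(\<Sum>k\<le>length w. (if take k w = [] then 1 else 0) * f (drop k w)) = f w"
      by simp
  qed
  show "f * 1 = f"
  proof (transfer, rule ext)
    fix f :: "'a list \<Rightarrow> 'b" and w :: "'a list"
    have "(\<Sum>k\<le>length w. f (take k w) * (if drop k w = [] then 1 else 0))
        = (\<Sum>k\<le>length w. if k = length w then f w else 0)"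
      by (rule sum.cong) auto
    then show "(\<Sum>k\<le>length w. f (take k w) * (if drop k w = [] then 1 else 0)) = f w"
      by simp
  qed
  show "(f + g) * h = f * h + g * h" "f * (g + h) = f * g + f * h"
    by (transfer, simp add: algebra_simps sum.distrib)+
  show "(0::('a, 'b) ncfps) \<noteq> 1"
    by transfer (metis zero_neq_one)
qed (transfer; simp add: algebra_simps)+

end

lift_definition nc_scale :: "'k::times \<Rightarrow> ('n, 'k) ncfps \<Rightarrow> ('n, 'k) ncfps"
  is "\<lambda>c f w. c * f w" .

lift_definition nc_var :: "'n \<Rightarrow> ('n, 'k::zero_neq_one) ncfps"
  is "\<lambda>i w. if w = [i] then 1 else 0" .

type_synonym ('n, 'k) nc_tuple = "'n \<Rightarrow> ('n, 'k) ncfps"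

text \<open>
  Substitution \<open>P(g)\<close>, for a tuple \<open>g\<close> whose components have zero constant term. Then
  \<open>g\<^sub>i\<^sub>1 \<cdots> g\<^sub>i\<^sub>m\<close> has no terms of degree below \<open>m\<close>, so that words longer than \<open>w\<close>
  do not contribute to the coefficient at \<open>w\<close>.
\<close>

lift_definition nc_subst ::
    "('n::finite, 'k::ring_1) ncfps \<Rightarrow> ('n, 'k) nc_tuple \<Rightarrow> ('n, 'k) ncfps"
  is "\<lambda>P g w. \<Sum>I | length I \<le> length w. P I * nc_coeff (prod_list (map g I)) w" .

definition nc_comp ::
    "('n::finite, 'k::ring_1) nc_tuple \<Rightarrow> ('n, 'k) nc_tuple \<Rightarrow> ('n, 'k) nc_tuple"
    (infixl "\<circ>\<^sub>n\<^sub>c" 55) where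
  "f \<circ>\<^sub>n\<^sub>c g = (\<lambda>i. nc_subst (f i) g)"

definition nc_linear :: "'k::ring_1 ^ 'n ^ 'n \<Rightarrow> ('n::finite, 'k) nc_tuple" where
  "nc_linear A = (\<lambda>i. \<Sum>j\<in>UNIV. nc_scale (A $ i $ j) (nc_var j))"


section \<open>Convergent series and the monoid of endomorphisms\<close>

definition conv_series :: "('k \<Rightarrow> real) \<Rightarrow> real \<Rightarrow> ('n, 'k) ncfps set" where
  "conv_series v r =
     {f. ((\<lambda>I. v (nc_coeff f I) * r ^ length I) \<longlongrightarrow> 0) (filtercomap length at_top)}"

definition nc_norm :: "('k \<Rightarrow> real) \<Rightarrow> real \<Rightarrow> ('n, 'k) ncfps \<Rightarrow> real" where
  "nc_norm v r f = (SUP I. v (nc_coeff f I) * r ^ length I)"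

definition aug_ideal :: "('k::zero \<Rightarrow> real) \<Rightarrow> real \<Rightarrow> ('n, 'k) ncfps set" where
  "aug_ideal v r = {f \<in> conv_series v r. nc_coeff f [] = 0}"

fun aug_ideal_power :: "('k::ring_1 \<Rightarrow> real) \<Rightarrow> real \<Rightarrow> nat \<Rightarrow> ('n, 'k) ncfps set" where
  "aug_ideal_power v r 0 = conv_series v r"
| "aug_ideal_power v r (Suc m) =
     {\<Sum>k<N. a k * b k | (N::nat) a b.
        \<forall>k<N. a k \<in> aug_ideal v r \<and> b k \<in> aug_ideal_power v r m}"

definition eq_upto_O :: "('k::ring_1 \<Rightarrow> real) \<Rightarrow> real \<Rightarrow> nat
    \<Rightarrow> ('n, 'k) nc_tuple \<Rightarrow> ('n, 'k) nc_tuple \<Rightarrow> bool" where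
  "eq_upto_O v r m f g \<longleftrightarrow> (\<forall>i. f i - g i \<in> aug_ideal_power v r m)"

definition End_op :: "('k::zero \<Rightarrow> real) \<Rightarrow> real \<Rightarrow> ('n, 'k) nc_tuple set" where
  "End_op v r = {f. \<forall>i. f i \<in> aug_ideal v r \<and> nc_norm v r (f i) \<le> r}"

definition inverse_in_End_op :: "('k::ring_1 \<Rightarrow> real) \<Rightarrow> real
    \<Rightarrow> ('n::finite, 'k) nc_tuple \<Rightarrow> ('n, 'k) nc_tuple \<Rightarrow> bool" where
  "inverse_in_End_op v r f g \<longleftrightarrow> f \<in> End_op v r \<and> g \<in> End_op v r \<and>
     f \<circ>\<^sub>n\<^sub>c g = nc_var \<and> g \<circ>\<^sub>n\<^sub>c f = nc_var"


section \<open>Semisimplicity\<close>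

definition invariant_subspace :: "'v set \<Rightarrow> 'v \<Rightarrow> ('v \<Rightarrow> 'v \<Rightarrow> 'v) \<Rightarrow> ('k \<Rightarrow> 'v \<Rightarrow> 'v)
    \<Rightarrow> ('v \<Rightarrow> 'v) \<Rightarrow> 'v set \<Rightarrow> bool" where
  "invariant_subspace V zer add smul T U \<longleftrightarrow> U \<subseteq> V \<and> zer \<in> U \<and>
     (\<forall>x\<in>U. \<forall>y\<in>U. add x y \<in> U) \<and> (\<forall>c. \<forall>x\<in>U. smul c x \<in> U) \<and> (\<forall>x\<in>U. T x \<in> U)"

definition semisimple_operator :: "'v set \<Rightarrow> 'v \<Rightarrow> ('v \<Rightarrow> 'v \<Rightarrow> 'v) \<Rightarrow> ('k \<Rightarrow> 'v \<Rightarrow> 'v)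
    \<Rightarrow> ('v \<Rightarrow> 'v) \<Rightarrow> bool" where
  "semisimple_operator V zer add smul T \<longleftrightarrow>
     (\<forall>U. invariant_subspace V zer add smul T U \<longrightarrow>
       (\<exists>U'. invariant_subspace V zer add smul T U' \<and> U \<inter> U' = {zer} \<and>
             {add x y | x y. x \<in> U \<and> y \<in> U'} = V))"

text \<open>
  The elements of the quotient of the convergent series by the \<open>m\<close>-th power \<open>W\<close> of the ideal are
  the cosets \<open>P +o W\<close>. Their sum is the elementwise sum of sets. For the other operations \<open>W\<close> is
  added again: the elementwise multiple of a coset by \<open>0\<close>, say, is not a coset.
\<close>

definition nc_semisimple :: "('k::ring_1 \<Rightarrow> real) \<Rightarrow> real \<Rightarrow> ('n::finite, 'k) nc_tuple \<Rightarrow> bool"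
  where
  "nc_semisimple v r f \<longleftrightarrow> (\<forall>m. let W = aug_ideal_power v r m in
     semisimple_operator ((\<lambda>P. P +o W) ` conv_series v r) W (+)
       (\<lambda>c C. \<Union>P\<in>C. nc_scale c P +o W)
       (\<lambda>C. \<Union>P\<in>C. nc_subst P f +o W))"


section \<open>Siegel's condition\<close>

definition siegel_condition :: "('k::field \<Rightarrow> real) \<Rightarrow> real \<Rightarrow> real \<Rightarrow> ('n::finite \<Rightarrow> 'k) \<Rightarrow> bool"
  where
  "siegel_condition v c \<mu> lam \<longleftrightarrow>
     (\<forall>(e :: 'n \<Rightarrow> nat) N j. N \<ge> 1 \<and> (\<Sum>k\<in>UNIV. e k) = N \<and> (\<Prod>k\<in>UNIV. lam k ^ e k) \<noteq> lam j \<longrightarrow>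
        v ((\<Prod>k\<in>UNIV. lam k ^ e k) - lam j) \<ge> c * (real N / 2) powr (- \<mu>))"

end

theory Submission imports Defs begin

text \<open>
  Newton iteration in the group of tuples \<open>\<psi> = x + O(x\<^sup>2)\<close> whose coefficients satisfy
  \<open>|\<psi>\<^sub>w| \<le> C\<^bsup>|w| - 1\<^esup>\<close>. By the ultrametric inequality these tuples form a group under composition,
  so conjugation loses nothing. If \<open>f\<close> agrees with its linear part up to degree
  \<open>M = 2\<^sup>s\<close>, dividing the coefficients of degrees \<open>M + 1, \<dots>, 2M\<close> by
  \<open>\<lambda>\<^sup>w - \<lambda>\<^sub>i\<close> yields a conjugation making \<open>f\<close> agree with its linear part up to degree \<open>2M\<close>;
  by Siegel's condition this costs a factor \<open>a\<^sub>s\<close> in \<open>C\<close> with \<open>a\<^sub>s\<^bsup>M\<^esup> = O(M\<^sup>\<mu>)\<close>, and the product of the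
  \<open>a\<^sub>s\<close> converges. Semisimplicity makes the resonant coefficients
  (\<open>\<lambda>\<^sup>w = \<lambda>\<^sub>i\<close>) of degrees up to \<open>2M\<close> vanish. The bound \<open>C\<^bsup>|w| - 1\<^esup>\<close> in the limit gives
  convergence on the disc of radius \<open>1 / (2 C)\<close>.
\<close>


section \<open>Substitution in noncommutative power series\<close>

lemma nc_coeff_simps [simp]:
  "nc_coeff 0 w = 0"
  "nc_coeff 1 w = (if w = [] then 1 else 0)"
  "nc_coeff (P + Q) w = nc_coeff P w + nc_coeff Q w"
  "nc_coeff (P - Q) w = nc_coeff P w - nc_coeff Q w"
  "nc_coeff (- P) w = - nc_coeff P w"
  "nc_coeff (nc_scale c R) w = c * nc_coeff R w"
  "nc_coeff (nc_var i) w = (if w = [i] then 1 else 0)"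
  by (transfer; simp)+

lemma nc_coeff_mult:
  "nc_coeff (P * Q) w = (\<Sum>k\<le>length w. nc_coeff P (take k w) * nc_coeff Q (drop k w))"
  by transfer simp

lemma nc_coeff_subst:
  "nc_coeff (nc_subst P g) w =
     (\<Sum>I | length I \<le> length w. nc_coeff P I * nc_coeff (prod_list (map g I)) w)"
  by transfer simp

lemma nc_coeff_Abs [simp]: "nc_coeff (Abs_ncfps a) w = a w"
  by (simp add: Abs_ncfps_inverse)

lemma nc_coeff_sum: "nc_coeff (\<Sum>x\<in>S. F x) w = (\<Sum>x\<in>S. nc_coeff (F x) w)"
  by (induction S rule: infinite_finite_induct) auto

lemma finite_words_le [simp]: "finite {I :: 'n::finite list. length I \<le> n}"
  using finite_lists_length_le[of "UNIV :: 'n set" n] by simp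

text \<open>The sum in \<open>nc_subst\<close> stops at words no longer than \<open>w\<close>. For
  vanishing constant terms this is the full substitution.\<close>

definition pointed :: "('n, 'k::zero) nc_tuple \<Rightarrow> bool" where
  "pointed g \<longleftrightarrow> (\<forall>i. nc_coeff (g i) [] = 0)"

text \<open>Congruence modulo series of order \<open>m + 1\<close>: the index is the last degree
  compared, one less than the matching exponent of the augmentation ideal.\<close>

definition nc_agree :: "nat \<Rightarrow> ('n, 'k) ncfps \<Rightarrow> ('n, 'k) ncfps \<Rightarrow> bool" where
  "nc_agree m P Q \<longleftrightarrow> (\<forall>w. length w \<le> m \<longrightarrow> nc_coeff P w = nc_coeff Q w)"

lemma pointed_var [simp]: "pointed nc_var"
  by (simp add: pointed_def)

lemma nc_agree_refl [simp]: "nc_agree m P P"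
  and nc_agree_sym: "nc_agree m P Q \<Longrightarrow> nc_agree m Q P"
  and nc_agree_trans: "nc_agree m P Q \<Longrightarrow> nc_agree m Q R \<Longrightarrow> nc_agree m P R"
  and nc_agree_mono: "nc_agree m P Q \<Longrightarrow> m' \<le> m \<Longrightarrow> nc_agree m' P Q"
  by (auto simp: nc_agree_def)

text \<open>Every factor has order at least 1, so orders add up to at least
  \<open>length I\<close>.\<close>

lemma nc_coeff_word_prod_0:
  fixes g :: "('n, 'k::ring_1) nc_tuple"
  assumes "pointed g" "length w < length I"
  shows "nc_coeff (prod_list (map g I)) w = 0"
  using assms(2)
proof (induction I arbitrary: w)
  case (Cons i I)
  have "nc_coeff (g i) (take k w) * nc_coeff (prod_list (map g I)) (drop k w) = 0"
    if "k \<le> length w" for k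
  proof (cases "k = 0")
    case True
    then show ?thesis using assms(1) by (simp add: pointed_def)
  next
    case False
    then show ?thesis using Cons that by simp
  qed
  then show ?case by (simp add: nc_coeff_mult)
qed simp

text \<open>Longer words add nothing, so the cutoff can be raised. This gives one finite index set
  for several words \<open>w\<close> at once.\<close>

lemma nc_coeff_subst_le:
  fixes g :: "('n::finite, 'k::ring_1) nc_tuple"
  assumes "pointed g" "length w \<le> N"
  shows "nc_coeff (nc_subst P g) w =
    (\<Sum>I | length I \<le> N. nc_coeff P I * nc_coeff (prod_list (map g I)) w)"
  unfolding nc_coeff_subst
  by (rule sum.mono_neutral_left) (use assms in \<open>auto simp: nc_coeff_word_prod_0\<close>)

text \<open>Cutting a word in two is inverse to concatenating two words, so both sides are the same
  sum over pairs of words.\<close>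

lemma nc_subst_mult:
  fixes g :: "('n::finite, 'k::comm_ring_1) nc_tuple"
  assumes g: "pointed g"
  shows "nc_subst (P * Q) g = nc_subst P g * nc_subst Q g"
proof (rule ncfps_eqI)
  fix w :: "'n list"
  define N where "N = length w"
  define G where "G = (\<lambda>I. prod_list (map g I))"
  define S where "S = {I :: 'n list. length I \<le> N}"
  have finS: "finite S" by (simp add: S_def)
  have G_app: "G (J @ L) = G J * G L" for J L by (simp add: G_def)
  have zero: "nc_coeff P J * nc_coeff Q L * nc_coeff (G J * G L) w = 0"
    if "\<not> length J + length L \<le> N" for J L
    using nc_coeff_word_prod_0[OF g, of w "J @ L"] that by (simp add: G_def N_def)
  have "nc_coeff (nc_subst (P * Q) g) w
      = (\<Sum>I\<in>S. \<Sum>k\<le>length I. nc_coeff P (take k I) * nc_coeff Q (drop k I) * nc_coeff (G I) w)"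
    by (simp add: nc_coeff_subst nc_coeff_mult sum_distrib_right G_def S_def N_def)
  also have "\<dots> = (\<Sum>(I, k)\<in>(SIGMA I:S. {..length I}).
      nc_coeff P (take k I) * nc_coeff Q (drop k I) * nc_coeff (G I) w)"
    by (rule sum.Sigma) (use finS in auto)
  also have "\<dots> = (\<Sum>(J, L)\<in>{(J, L). length J + length L \<le> N}.
      nc_coeff P J * nc_coeff Q L * nc_coeff (G J * G L) w)"
    by (rule sum.reindex_bij_witness[where i = "\<lambda>(J, L). (J @ L, length J)"
          and j = "\<lambda>(I, k). (take k I, drop k I)"]) (auto simp: S_def simp flip: G_app)
  \<comment> \<open>Pairs of total length above \<open>N\<close> vanish, which completes the
    triangle to a square on which the two sums separate.\<close>
  also have "\<dots> = (\<Sum>(J, L)\<in>S \<times> S. nc_coeff P J * nc_coeff Q L * nc_coeff (G J * G L) w)"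
  proof (rule sum.mono_neutral_left)
    show "\<forall>x\<in>S \<times> S - {(J, L). length J + length L \<le> N}.
        (case x of (J, L) \<Rightarrow> nc_coeff P J * nc_coeff Q L * nc_coeff (G J * G L) w) = 0"
      by (auto intro!: zero)
  qed (use finS in \<open>auto simp: S_def\<close>)
  also have "\<dots> = (\<Sum>(J, L)\<in>S \<times> S. \<Sum>k\<le>N.
      (nc_coeff P J * nc_coeff (G J) (take k w)) * (nc_coeff Q L * nc_coeff (G L) (drop k w)))"
    by (simp add: nc_coeff_mult sum_distrib_left N_def mult_ac)
  also have "\<dots> = (\<Sum>k\<le>N. \<Sum>(J, L)\<in>S \<times> S.
      (nc_coeff P J * nc_coeff (G J) (take k w)) * (nc_coeff Q L * nc_coeff (G L) (drop k w)))"
    by (subst sum.swap) (simp add: case_prod_unfold)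
  also have "\<dots> = (\<Sum>k\<le>N. nc_coeff (nc_subst P g) (take k w) * nc_coeff (nc_subst Q g) (drop k w))"
    by (rule sum.cong)
      (simp_all add: nc_coeff_subst_le[OF g, of _ N] sum_product sum.cartesian_product
        S_def G_def N_def)
  finally show "nc_coeff (nc_subst (P * Q) g) w = nc_coeff (nc_subst P g * nc_subst Q g) w"
    by (simp add: nc_coeff_mult N_def)
qed

lemma nc_subst_1 [simp]:
  fixes g :: "('n::finite, 'k::ring_1) nc_tuple"
  shows "nc_subst 1 g = 1"
proof (rule ncfps_eqI)
  fix w :: "'n list"
  have "nc_coeff (nc_subst 1 g) w = (\<Sum>I :: 'n list | length I \<le> length w. if I = [] then nc_coeff 1 w else 0)"
    unfolding nc_coeff_subst by (rule sum.cong) auto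
  then show "nc_coeff (nc_subst 1 g) w = nc_coeff 1 w" by (simp add: sum.delta)
qed

lemma nc_subst_add: "nc_subst (P + Q) g = nc_subst P g + nc_subst Q g"
  and nc_subst_diff: "nc_subst (P - Q) g = nc_subst P g - nc_subst Q g"
  by (rule ncfps_eqI, simp add: nc_coeff_subst algebra_simps sum.distrib sum_subtractf)+

lemma nc_subst_scale: "nc_subst (nc_scale c P) g = nc_scale c (nc_subst P g)"
  by (rule ncfps_eqI, simp add: nc_coeff_subst sum_distrib_left mult.assoc)

lemma nc_subst_var:
  assumes "pointed g"
  shows "nc_subst (nc_var i) g = g i"
proof (rule ncfps_eqI)
  fix w
  have "nc_coeff (nc_subst (nc_var i) g) w
      = (\<Sum>I | length I \<le> length w. if I = [i] then nc_coeff (g i) w else 0)"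
    unfolding nc_coeff_subst by (rule sum.cong) auto
  \<comment> \<open>At the empty word the cutoff excludes \<open>[i]\<close>, so the sum is 0, which
    is the constant term of \<open>g i\<close>.\<close>
  then show "nc_coeff (nc_subst (nc_var i) g) w = nc_coeff (g i) w"
    using assms by (cases w) (auto simp: sum.delta pointed_def)
qed

text \<open>The eigenvalue of the monomial \<open>w\<close> under substitution of the diagonal
  tuple; resonance is the equation \<open>word_eval lam w = lam i\<close>.\<close>

definition word_eval :: "('n \<Rightarrow> 'k::monoid_mult) \<Rightarrow> 'n list \<Rightarrow> 'k" where
  "word_eval lam w = prod_list (map lam w)"

lemma nc_coeff_prod_diag:
  fixes lam :: "'n \<Rightarrow> 'k::comm_ring_1"
  shows "nc_coeff (prod_list (map (\<lambda>i. nc_scale (lam i) (nc_var i)) I)) w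
    = (if w = I then word_eval lam I else 0)"
proof (induction I arbitrary: w)
  case (Cons i I)
  have "nc_coeff (nc_scale (lam i) (nc_var i)) (take k w) *
        nc_coeff (prod_list (map (\<lambda>i. nc_scale (lam i) (nc_var i)) I)) (drop k w)
      = (if k = 1 then (if w = i # I then word_eval lam (i # I) else 0) else 0)"
    if "k \<le> length w" for k
  proof (cases "k = 1")
    case True
    then show ?thesis using that by (cases w) (auto simp: Cons.IH word_eval_def)
  next
    case False
    then have "take k w \<noteq> [i]" using that by (auto dest: arg_cong[where f = length])
    then show ?thesis using False by simp
  qed
  then have "nc_coeff (prod_list (map (\<lambda>i. nc_scale (lam i) (nc_var i)) (i # I))) w
      = (\<Sum>k\<le>length w. if k = 1 then (if w = i # I then word_eval lam (i # I) else 0) else 0)"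
    by (simp add: nc_coeff_mult del: nc_coeff_simps)
  then show ?case by (auto simp: sum.delta)
qed (simp add: word_eval_def)

text \<open>Monomials are eigenvectors, so the linearised conjugacy equation can be solved one
  coefficient at a time.\<close>

lemma nc_coeff_subst_diag:
  fixes lam :: "'n::finite \<Rightarrow> 'k::comm_ring_1"
  shows "nc_coeff (nc_subst P (\<lambda>i. nc_scale (lam i) (nc_var i))) w = nc_coeff P w * word_eval lam w"
  by (simp add: nc_coeff_subst nc_coeff_prod_diag if_distrib[where f = "\<lambda>x. _ * x"] sum.delta cong: if_cong)

lemma nc_coeff_word_prod_var:
  fixes I :: "'n list"
  shows "nc_coeff (prod_list (map nc_var I)) w = (if w = I then 1 else (0 :: 'k::comm_ring_1))"
proof -
  have "nc_var = (\<lambda>i :: 'n. nc_scale (1 :: 'k) (nc_var i))" by (intro ext ncfps_eqI) simp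
  moreover have "word_eval (\<lambda>_. 1 :: 'k) I = 1" by (induction I) (auto simp: word_eval_def)
  ultimately show ?thesis using nc_coeff_prod_diag[of "\<lambda>_. 1 :: 'k" I w] by simp
qed

lemma nc_subst_nc_var [simp]:
  fixes P :: "('n::finite, 'k::comm_ring_1) ncfps"
  shows "nc_subst P nc_var = P"
  by (rule ncfps_eqI) (simp add: nc_coeff_subst nc_coeff_word_prod_var
    if_distrib[where f = "\<lambda>x. _ * x"] sum.delta cong: if_cong)

section \<open>Composition of pointed tuples\<close>

lemma pointed_comp [simp]: "pointed f \<Longrightarrow> pointed (f \<circ>\<^sub>n\<^sub>c g)"
  by (simp add: pointed_def nc_comp_def nc_coeff_subst)

lemma nc_subst_word_prod:
  fixes g h :: "('n::finite, 'k::comm_ring_1) nc_tuple"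
  assumes "pointed h"
  shows "nc_subst (prod_list (map g I)) h = prod_list (map (g \<circ>\<^sub>n\<^sub>c h) I)"
  by (induction I) (simp_all add: nc_subst_mult[OF assms] nc_comp_def)

text \<open>Substituting \<open>h\<close> is multiplicative, so it passes through the product of the
  \<open>g i\<close> along each word; what remains is an interchange of finite sums.\<close>

lemma nc_subst_subst:
  fixes g h :: "('n::finite, 'k::comm_ring_1) nc_tuple"
  assumes g: "pointed g" and h: "pointed h"
  shows "nc_subst (nc_subst P g) h = nc_subst P (g \<circ>\<^sub>n\<^sub>c h)"
proof (rule ncfps_eqI)
  fix w :: "'n list"
  define S where "S = {I :: 'n list. length I \<le> length w}"
  have "nc_coeff (nc_subst (nc_subst P g) h) w
    = (\<Sum>J\<in>S. (\<Sum>I\<in>S. nc_coeff P I * nc_coeff (prod_list (map g I)) J) *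
         nc_coeff (prod_list (map h J)) w)"
    unfolding nc_coeff_subst[of "nc_subst P g"] S_def
    by (rule sum.cong) (simp_all add: nc_coeff_subst_le[OF g, of _ "length w"])
  also have "\<dots> = (\<Sum>I\<in>S. nc_coeff P I *
      (\<Sum>J\<in>S. nc_coeff (prod_list (map g I)) J * nc_coeff (prod_list (map h J)) w))"
    by (simp add: sum_distrib_left sum_distrib_right mult.assoc, rule sum.swap)
  also have "\<dots> = (\<Sum>I\<in>S. nc_coeff P I * nc_coeff (prod_list (map (g \<circ>\<^sub>n\<^sub>c h) I)) w)"
    by (simp add: S_def flip: nc_coeff_subst nc_subst_word_prod[OF h])
  finally show "nc_coeff (nc_subst (nc_subst P g) h) w = nc_coeff (nc_subst P (g \<circ>\<^sub>n\<^sub>c h)) w"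
    by (simp add: nc_coeff_subst S_def)
qed

lemma nc_comp_assoc:
  fixes f g h :: "('n::finite, 'k::comm_ring_1) nc_tuple"
  assumes "pointed g" "pointed h"
  shows "(f \<circ>\<^sub>n\<^sub>c g) \<circ>\<^sub>n\<^sub>c h = f \<circ>\<^sub>n\<^sub>c (g \<circ>\<^sub>n\<^sub>c h)"
  using nc_subst_subst[OF assms] by (simp add: nc_comp_def)

lemma nc_comp_var_right [simp]:
  fixes f :: "('n::finite, 'k::comm_ring_1) nc_tuple"
  shows "f \<circ>\<^sub>n\<^sub>c nc_var = f"
  by (simp add: nc_comp_def)

lemma nc_comp_var_left [simp]: "pointed g \<Longrightarrow> nc_var \<circ>\<^sub>n\<^sub>c g = g"
  by (simp add: nc_comp_def nc_subst_var)

section \<open>Congruences up to a given degree\<close>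

lemma nc_agree_subst:
  "nc_agree m P Q \<Longrightarrow> nc_agree m (nc_subst P g) (nc_subst Q g)"
  unfolding nc_agree_def nc_coeff_subst by (intro allI impI sum.cong) auto

lemma nc_agree_mult:
  "nc_agree m P P' \<Longrightarrow> nc_agree m Q Q' \<Longrightarrow> nc_agree m (P * Q) (P' * Q')"
  by (auto simp: nc_agree_def nc_coeff_mult intro!: sum.cong)

lemma nc_agree_subst_right:
  assumes "\<And>i. nc_agree m (g i) (g' i)"
  shows "nc_agree m (nc_subst P g) (nc_subst P g')"
proof -
  have "nc_agree m (prod_list (map g I)) (prod_list (map g' I))" for I
    by (induction I) (auto intro!: nc_agree_mult assms)
  then show ?thesis
    unfolding nc_agree_def nc_coeff_subst by (intro allI impI sum.cong) auto
qed

text \<open>Exchanging one factor alters the product only from degree \<open>m + 1\<close> plus the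
  order of the other \<open>length I - 1\<close> factors, that is from degree
  \<open>m + length I\<close> on.\<close>

lemma nc_agree_word_prod:
  fixes g g' :: "('n, 'k::ring_1) nc_tuple"
  assumes g: "pointed g" "pointed g'" and gg': "\<And>i. nc_agree m (g i) (g' i)"
    and w: "length w < m + length I"
  shows "nc_coeff (prod_list (map g I)) w = nc_coeff (prod_list (map g' I)) w"
  using w
proof (induction I arbitrary: w)
  case (Cons i I)
  have "nc_coeff (g i) (take k w) * nc_coeff (prod_list (map g I)) (drop k w) =
      nc_coeff (g' i) (take k w) * nc_coeff (prod_list (map g' I)) (drop k w)"
    if k: "k \<le> length w" for k
  proof -
    \<comment> \<open>Either the first factor contributes its constant term 0, or the remaining word
      is too short for the remaining factors, or \<open>k \<le> m\<close> and the induction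
      hypothesis applies to the rest.\<close>
    consider "k = 0" | "length w - k < length I" | "k > 0" "length w - k \<ge> length I" by linarith
    then show ?thesis
    proof cases
      case 3
      then show ?thesis using Cons gg' k by (auto simp: nc_agree_def)
    qed (use g in \<open>auto simp: pointed_def nc_coeff_word_prod_0\<close>)
  qed
  then show ?case by (simp add: nc_coeff_mult)
qed simp

text \<open>With \<open>k = m + 1\<close>, this is what doubles the order at each Newton step.\<close>

lemma nc_agree_subst_order:
  fixes g g' :: "('n::finite, 'k::ring_1) nc_tuple"
  assumes g: "pointed g" "pointed g'" and gg': "\<And>i. nc_agree m (g i) (g' i)"
    and P: "\<And>w. length w < k \<Longrightarrow> nc_coeff P w = 0" and n: "n < m + k"
  shows "nc_agree n (nc_subst P g) (nc_subst P g')"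
  unfolding nc_agree_def nc_coeff_subst
proof (intro allI impI sum.cong refl)
  fix w I :: "'n list" assume w: "length w \<le> n"
  show "nc_coeff P I * nc_coeff (prod_list (map g I)) w =
      nc_coeff P I * nc_coeff (prod_list (map g' I)) w"
  proof (cases "length I < k")
    case False
    then show ?thesis using nc_agree_word_prod[OF g gg', of w I] w n by simp
  qed (simp add: P)
qed


section \<open>Unipotent tuples and geometric coefficient bounds\<close>

definition unipotent :: "('n, 'k::ring_1) nc_tuple \<Rightarrow> bool" where
  "unipotent f \<longleftrightarrow> (\<forall>i. nc_agree 1 (f i) (nc_var i))"

lemma unipotent_pointed: "unipotent f \<Longrightarrow> pointed f"
  by (auto simp: unipotent_def pointed_def nc_agree_def)

text \<open>The lowest-degree part of the product is the monomial \<open>I\<close> itself. These are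
  the diagonal ones of the triangular system for the inverse.\<close>

lemma nc_coeff_word_prod_unipotent:
  fixes f :: "('n, 'k::comm_ring_1) nc_tuple"
  assumes "unipotent f" "length w = length I"
  shows "nc_coeff (prod_list (map f I)) w = (if w = I then 1 else 0)"
  using nc_agree_word_prod[OF unipotent_pointed[OF assms(1)] pointed_var, of 1 w I] assms
  by (simp add: unipotent_def nc_coeff_word_prod_var)

text \<open>The coefficients of the left inverse \<open>g\<close> of a unipotent tuple \<open>f\<close>: the equation
  \<open>g \<circ>\<^sub>n\<^sub>c f = nc_var\<close> is linear in \<open>g\<close> and unitriangular.\<close>

function inv_coeff :: "('n::finite, 'k::comm_ring_1) nc_tuple \<Rightarrow> 'n \<Rightarrow> 'n list \<Rightarrow> 'k" where
  "inv_coeff f i w = (if length w \<le> 1 then (if w = [i] then 1 else 0) else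
     - (\<Sum>I | length I < length w. inv_coeff f i I * nc_coeff (prod_list (map f I)) w))"
  by auto
termination by (relation "Wellfounded.measure (\<lambda>(f, i, w). length w)") auto

declare inv_coeff.simps [simp del]

definition left_inverse :: "('n::finite, 'k::comm_ring_1) nc_tuple \<Rightarrow> ('n, 'k) nc_tuple" where
  "left_inverse f = (\<lambda>i. Abs_ncfps (inv_coeff f i))"

lemma unipotent_left_inverse: "unipotent (left_inverse f)"
  by (auto simp: unipotent_def nc_agree_def left_inverse_def inv_coeff.simps)

lemma left_inverse_comp:
  fixes f :: "('n::finite, 'k::comm_ring_1) nc_tuple"
  assumes "unipotent f"
  shows "left_inverse f \<circ>\<^sub>n\<^sub>c f = nc_var"
proof (intro ext ncfps_eqI)
  fix i :: 'n and w :: "'n list"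
  let ?t = "\<lambda>I. inv_coeff f i I * nc_coeff (prod_list (map f I)) w"
  have fin: "finite {I :: 'n list. length I < length w}"
    by (rule finite_subset[OF _ finite_words_le[of "length w"]]) auto
  have fin': "finite {I :: 'n list. length I = length w}"
    by (rule finite_subset[OF _ finite_words_le[of "length w"]]) auto
  have split: "{I :: 'n list. length I \<le> length w} =
      {I. length I < length w} \<union> {I. length I = length w}" by auto
  have "nc_coeff ((left_inverse f \<circ>\<^sub>n\<^sub>c f) i) w
      = (\<Sum>I | length I < length w. ?t I) + (\<Sum>I | length I = length w. ?t I)"
    by (simp add: nc_comp_def nc_coeff_subst left_inverse_def split)
      (rule sum.union_disjoint, use fin fin' in auto)
  also have "(\<Sum>I | length I = length w. ?t I)
      = (\<Sum>I | length I = length w. if I = w then inv_coeff f i w else 0)"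
    by (rule sum.cong) (use assms in \<open>auto simp: nc_coeff_word_prod_unipotent\<close>)
  also have "\<dots> = inv_coeff f i w" using fin' by (simp add: sum.delta)
  also have "(\<Sum>I | length I < length w. ?t I) + inv_coeff f i w = (if w = [i] then 1 else 0)"
  proof (cases "length w \<le> 1")
    case True
    \<comment> \<open>The only possible shorter word is the empty one, where
      \<open>inv_coeff\<close> is 0.\<close>
    have "(\<Sum>I | length I < length w. ?t I) = 0"
      using True by (intro sum.neutral) (auto simp: inv_coeff.simps)
    then show ?thesis using True by (simp add: inv_coeff.simps)
  next
    case False
    then show ?thesis by (subst inv_coeff.simps[of f i w]) auto
  qed
  finally show "nc_coeff ((left_inverse f \<circ>\<^sub>n\<^sub>c f) i) w = nc_coeff (nc_var i) w" by simp
qed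

text \<open>The left inverse of \<open>f\<close> has a left inverse too, and associativity forces
  that one to be \<open>f\<close>.\<close>

lemma comp_left_inverse:
  fixes f :: "('n::finite, 'k::comm_ring_1) nc_tuple"
  assumes f: "unipotent f"
  shows "f \<circ>\<^sub>n\<^sub>c left_inverse f = nc_var"
proof -
  let ?g = "left_inverse f" and ?h = "left_inverse (left_inverse f)"
  note p = unipotent_pointed[OF f] unipotent_pointed[OF unipotent_left_inverse]
  have "?h = ?h \<circ>\<^sub>n\<^sub>c (?g \<circ>\<^sub>n\<^sub>c f)" by (simp add: left_inverse_comp f)
  also have "\<dots> = (?h \<circ>\<^sub>n\<^sub>c ?g) \<circ>\<^sub>n\<^sub>c f" by (simp add: nc_comp_assoc p)
  also have "\<dots> = f" by (simp add: left_inverse_comp unipotent_left_inverse p)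
  finally show ?thesis using left_inverse_comp[OF unipotent_left_inverse, of f] by simp
qed

section \<open>Coefficient bounds for an ultrametric absolute value\<close>

locale nonarchimedean_abs =
  fixes v :: "'k::field \<Rightarrow> real"
  assumes v_nonneg: "v x \<ge> 0"
    and v_eq_0_iff: "v x = 0 \<longleftrightarrow> x = 0"
    and v_mult: "v (x * y) = v x * v y"
    and v_ultrametric: "v (x + y) \<le> max (v x) (v y)"
begin

lemma v_0 [simp]: "v 0 = 0"
  by (simp add: v_eq_0_iff)

lemma v_1 [simp]: "v 1 = 1"
  using v_mult[of 1 1] v_eq_0_iff[of 1] by simp

lemma v_minus [simp]: "v (- x) = v x"
proof -
  have "v (- 1) * v (- 1) = 1" by (simp flip: v_mult)
  then have "v (- 1) = 1" using v_nonneg[of "- 1"] by (simp add: square_eq_1_iff)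
  then show ?thesis using v_mult[of "- 1" x] by simp
qed

lemma v_divide: "v (x / y) = v x / v y"
proof (cases "y = 0")
  case False
  then show ?thesis using v_mult[of "x / y" y] v_eq_0_iff[of y] by (simp add: field_simps)
qed simp

lemma v_sum_le:
  assumes "\<And>x. x \<in> S \<Longrightarrow> v (F x) \<le> B" "0 \<le> B"
  shows "v (sum F S) \<le> B"
  using assms
proof (induction S rule: infinite_finite_induct)
  case (insert x S)
  then show ?case using v_ultrametric[of "F x" "sum F S"] by (auto intro: order_trans)
qed auto

text \<open>For series of order at least \<open>k\<close>, the estimate of the coefficient at
  \<open>w\<close> by C to the power |w| - k, multiplied out to avoid natural-number
  subtraction.\<close>

definition nc_bound :: "real \<Rightarrow> nat \<Rightarrow> ('n, 'k) ncfps \<Rightarrow> bool" where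
  "nc_bound C k P \<longleftrightarrow> (\<forall>w. (length w < k \<longrightarrow> nc_coeff P w = 0) \<and>
     v (nc_coeff P w) * C ^ k \<le> C ^ length w)"

text \<open>With order 1 and \<open>C > 0\<close>, linear coefficients have absolute value at most 1
  whatever \<open>C\<close> is; only higher degrees feel the constant.\<close>

definition tuple_bound :: "real \<Rightarrow> ('n, 'k) nc_tuple \<Rightarrow> bool" where
  "tuple_bound C f \<longleftrightarrow> (\<forall>i. nc_bound C 1 (f i))"

lemma tuple_bound_pointed: "tuple_bound C f \<Longrightarrow> pointed f"
  by (auto simp: tuple_bound_def nc_bound_def pointed_def)

lemma tuple_bound_var [simp]: "C > 0 \<Longrightarrow> tuple_bound C nc_var"
  by (auto simp: tuple_bound_def nc_bound_def)

text \<open>The exponents of the two factors add, and the ultrametric inequality keeps the number of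
  splittings of \<open>w\<close> out of the bound.\<close>

lemma nc_bound_mult:
  fixes P Q :: "('n, 'k) ncfps"
  assumes P: "nc_bound C k P" and Q: "nc_bound C l Q" and C: "C > 0"
  shows "nc_bound C (k + l) (P * Q)"
  unfolding nc_bound_def
proof (intro allI conjI impI)
  fix w :: "'n list"
  show "nc_coeff (P * Q) w = 0" if "length w < k + l"
    unfolding nc_coeff_mult
  proof (rule sum.neutral, rule ballI)
    fix j assume "j \<in> {..length w}"
    then have "length (take j w) < k \<or> length (drop j w) < l" using that by auto
    then show "nc_coeff P (take j w) * nc_coeff Q (drop j w) = 0"
      using P Q by (auto simp: nc_bound_def simp del: length_take length_drop)
  qed
  have "v (nc_coeff (P * Q) w) \<le> C ^ length w / C ^ (k + l)"
    unfolding nc_coeff_mult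
  proof (rule v_sum_le)
    fix j assume j: "j \<in> {..length w}"
    have "v (nc_coeff P (take j w)) * C ^ k * (v (nc_coeff Q (drop j w)) * C ^ l)
        \<le> C ^ length (take j w) * C ^ length (drop j w)"
      using P Q C by (intro mult_mono) (auto simp: nc_bound_def v_nonneg simp del: length_take length_drop)
    also have "\<dots> = C ^ length w" using j by (simp flip: power_add)
    finally show "v (nc_coeff P (take j w) * nc_coeff Q (drop j w)) \<le> C ^ length w / C ^ (k + l)"
      using C by (simp add: v_mult field_simps power_add)
  qed (use C in simp)
  then show "v (nc_coeff (P * Q) w) * C ^ (k + l) \<le> C ^ length w"
    using C by (simp add: field_simps)
qed

lemma nc_bound_word_prod:
  assumes "tuple_bound C g" "C > 0"
  shows "nc_bound C (length I) (prod_list (map g I))"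
proof (induction I)
  case Nil
  then show ?case using assms by (auto simp: nc_bound_def)
next
  case (Cons i I)
  then show ?case using nc_bound_mult[of C 1 "g i" "length I"] assms by (auto simp: tuple_bound_def)
qed

text \<open>The exponents |I| - k and |w| - |I| add up to |w| - k, independently of
  \<open>I\<close>. This serves both substitution and inversion.\<close>

lemma nc_bound_term:
  assumes g: "tuple_bound C g" and C: "C > 0" and a: "v a * C ^ k \<le> C ^ length I"
  shows "v (a * nc_coeff (prod_list (map g I)) w) \<le> C ^ length w / C ^ k"
proof -
  have "v a * C ^ k * v (nc_coeff (prod_list (map g I)) w)
      \<le> C ^ length I * v (nc_coeff (prod_list (map g I)) w)"
    using a by (intro mult_right_mono v_nonneg)
  also have "\<dots> \<le> C ^ length w"
    using nc_bound_word_prod[OF g C, of I] by (simp add: nc_bound_def mult.commute)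
  finally show ?thesis using C by (simp add: v_mult field_simps)
qed

lemma nc_bound_subst:
  fixes P :: "('n::finite, 'k) ncfps"
  assumes P: "nc_bound C k P" and g: "tuple_bound C g" and C: "C > 0"
  shows "nc_bound C k (nc_subst P g)"
  unfolding nc_bound_def
proof (intro allI conjI impI)
  fix w :: "'n list"
  show "nc_coeff (nc_subst P g) w = 0" if "length w < k"
    using P that by (auto simp: nc_bound_def nc_coeff_subst)
  have "v (nc_coeff (nc_subst P g) w) \<le> C ^ length w / C ^ k"
    unfolding nc_coeff_subst
    by (rule v_sum_le) (use P C in \<open>auto intro!: nc_bound_term[OF g] simp: nc_bound_def\<close>)
  then show "v (nc_coeff (nc_subst P g) w) * C ^ k \<le> C ^ length w"
    using C by (simp add: field_simps)
qed

lemma tuple_bound_comp: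
  fixes f :: "('n::finite, 'k) nc_tuple"
  shows "tuple_bound C f \<Longrightarrow> tuple_bound C g \<Longrightarrow> C > 0 \<Longrightarrow> tuple_bound C (f \<circ>\<^sub>n\<^sub>c g)"
  unfolding tuple_bound_def nc_comp_def by (auto intro!: nc_bound_subst simp: tuple_bound_def)

text \<open>On nonempty words the exponent |w| - 1 is nonnegative, and the empty word has
  coefficient 0.\<close>

lemma tuple_bound_mono:
  assumes "tuple_bound C f" "0 < C" "C \<le> C'"
  shows "tuple_bound C' f"
  unfolding tuple_bound_def nc_bound_def
proof (intro allI conjI impI)
  fix i and w :: "'a list"
  note * = assms(1)[unfolded tuple_bound_def nc_bound_def, rule_format, of w i]
  show "nc_coeff (f i) w = 0" if "length w < 1" using * that by simp
  show "v (nc_coeff (f i) w) * C' ^ 1 \<le> C' ^ length w"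
  proof (cases w)
    case (Cons a u)
    then have "v (nc_coeff (f i) w) \<le> C ^ length u" using * assms(2) by simp
    also have "\<dots> \<le> C' ^ length u" using assms by (intro power_mono) auto
    finally show ?thesis using Cons assms by (simp add: mult.commute mult_left_mono)
  qed (use * in simp)
qed

text \<open>Induction along the recursion: each summand obeys the bound with the same
  \<open>C\<close>, hence so does their sum.\<close>

lemma tuple_bound_left_inverse:
  fixes f :: "('n::finite, 'k) nc_tuple"
  assumes f: "tuple_bound C f" and C: "C > 0"
  shows "tuple_bound C (left_inverse f)"
proof -
  have bnd: "v (inv_coeff f i w) * C ^ 1 \<le> C ^ length w" for i w
  proof (induction w rule: measure_induct_rule[of length])
    case (less w)
    show ?case
    proof (cases "length w \<le> 1")
      case True
      then show ?thesis using C by (auto simp: inv_coeff.simps)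
    next
      case False
      have "v (\<Sum>I | length I < length w. inv_coeff f i I * nc_coeff (prod_list (map f I)) w)
          \<le> C ^ length w / C ^ 1"
        by (rule v_sum_le, rule nc_bound_term[OF f C], rule less, use C in auto)
      then show ?thesis using False C by (subst inv_coeff.simps) (simp add: field_simps)
    qed
  qed
  show ?thesis
    using bnd unipotent_pointed[OF unipotent_left_inverse, of f]
    by (auto simp: tuple_bound_def nc_bound_def left_inverse_def pointed_def)
qed

end

lemma (in finite_extension_padic) nonarchimedean: "nonarchimedean_abs v"
  by unfold_locales (simp_all add: abs_nonneg abs_eq_0_iff abs_mult abs_ultrametric)


section \<open>Convergent series and powers of the augmentation ideal\<close>

text \<open>The quotients in the definition of semisimplicity consist of literal cosets; these rules
  turn statements about them into membership of differences in \<open>W\<close>.\<close>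

lemma add_subgroup_cosets:
  fixes W :: "'a::ab_group_add set"
  assumes W: "0 \<in> W" "\<And>x y. x \<in> W \<Longrightarrow> y \<in> W \<Longrightarrow> x - y \<in> W"
  shows coset_eq_iff: "P +o W = Q +o W \<longleftrightarrow> P - Q \<in> W"
    and coset_add: "(P +o W) + (Q +o W) = (P + Q) +o W"
    and coset_mem_iff: "P \<in> Q +o W \<longleftrightarrow> P - Q \<in> W"
proof -
  have uminus: "- x \<in> W" if "x \<in> W" for x using W(2)[OF W(1) that] by simp
  have plus: "x + y \<in> W" if "x \<in> W" "y \<in> W" for x y
    using W(2)[OF that(1) uminus[OF that(2)]] by simp
  show mem: "P \<in> Q +o W \<longleftrightarrow> P - Q \<in> W" for P Q
    by (auto simp: elt_set_plus_def algebra_simps intro!: bexI[of _ "P - Q"])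
  have self: "P \<in> P +o W" for P using W(1) by (simp add: mem)
  show "P +o W = Q +o W \<longleftrightarrow> P - Q \<in> W"
  proof
    assume PQ: "P - Q \<in> W"
    show "P +o W = Q +o W"
    proof (rule set_eqI)
      fix x
      have "x - Q = (x - P) + (P - Q)" "x - P = (x - Q) - (P - Q)" by simp_all
      then show "x \<in> P +o W \<longleftrightarrow> x \<in> Q +o W" using PQ W(2) plus by (metis mem)
    qed
  qed (use self[of P] mem in blast)
  have "W + W = W"
  proof
    show "W + W \<subseteq> W" by (auto simp: set_plus_def plus)
    show "W \<subseteq> W + W" using W(1) by (force simp: set_plus_def)
  qed
  then show "(P +o W) + (Q +o W) = (P + Q) +o W"
    by (simp add: set_plus_rearrange)
qed

section \<open>Convergent series on the disc of radius \<open>r\<close>\<close>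

locale nonarchimedean_disc = nonarchimedean_abs v for v :: "'k::field \<Rightarrow> real" +
  fixes r :: real
  assumes r_pos: "r > 0"
begin

lemma conv_series_iff:
  "P \<in> conv_series v r \<longleftrightarrow> (\<forall>e>0. \<exists>N. \<forall>w. N \<le> length w \<longrightarrow> v (nc_coeff P w) * r ^ length w < e)"
proof -
  have "\<bar>v (nc_coeff P w) * r ^ length w\<bar> = v (nc_coeff P w) * r ^ length w" for w
    using r_pos v_nonneg by simp
  then show ?thesis
    by (simp only: conv_series_def mem_Collect_eq tendsto_iff dist_real_def diff_0_right
        eventually_filtercomap_at_top_linorder)
qed

lemma conv_seriesE:
  assumes "P \<in> conv_series v r" "e > 0"
  obtains N :: nat where "\<And>w. N \<le> length w \<Longrightarrow> v (nc_coeff P w) * r ^ length w < e"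
  using assms(1)[unfolded conv_series_iff, rule_format, OF assms(2)] by blast

lemma conv_series_0: "0 \<in> conv_series v r"
  by (auto simp: conv_series_iff)

lemma conv_series_add:
  assumes "P \<in> conv_series v r" "Q \<in> conv_series v r"
  shows "P + Q \<in> conv_series v r"
  unfolding conv_series_iff
proof (intro allI impI)
  fix e :: real assume e: "e > 0"
  obtain N1 where N1: "\<And>w. N1 \<le> length w \<Longrightarrow> v (nc_coeff P w) * r ^ length w < e"
    using conv_seriesE[OF assms(1) e] by blast
  obtain N2 where N2: "\<And>w. N2 \<le> length w \<Longrightarrow> v (nc_coeff Q w) * r ^ length w < e"
    using conv_seriesE[OF assms(2) e] by blast
  have "v (nc_coeff (P + Q) w) * r ^ length w < e" if "max N1 N2 \<le> length w" for w
  proof -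
    have "v (nc_coeff (P + Q) w) * r ^ length w
        \<le> max (v (nc_coeff P w)) (v (nc_coeff Q w)) * r ^ length w"
      using r_pos v_ultrametric by (intro mult_right_mono) auto
    also have "\<dots> < e"
    proof -
      have "N1 \<le> length w" "N2 \<le> length w" using that by auto
      then show ?thesis using N1[of w] N2[of w] by (simp add: max_def)
    qed
    finally show ?thesis .
  qed
  then show "\<exists>N. \<forall>w. N \<le> length w \<longrightarrow> v (nc_coeff (P + Q) w) * r ^ length w < e" by blast
qed

lemma conv_series_scale:
  assumes "P \<in> conv_series v r"
  shows "nc_scale c P \<in> conv_series v r"
proof (cases "c = 0")
  case False
  then have c: "v c > 0" using v_nonneg[of c] v_eq_0_iff[of c] by linarith
  show ?thesis
    unfolding conv_series_iff
  proof (intro allI impI)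
    fix e :: real assume "e > 0"
    then obtain N where "\<And>w. N \<le> length w \<Longrightarrow> v (nc_coeff P w) * r ^ length w < e / v c"
      using conv_seriesE[OF assms, of "e / v c"] c by auto
    then show "\<exists>N. \<forall>w. N \<le> length w \<longrightarrow> v (nc_coeff (nc_scale c P) w) * r ^ length w < e"
      using c by (intro exI[of _ N]) (auto simp: v_mult field_simps)
  qed
qed (auto simp: conv_series_iff)

lemma conv_series_diff:
  assumes "P \<in> conv_series v r" "Q \<in> conv_series v r"
  shows "P - Q \<in> conv_series v r"
proof -
  have "P - Q = P + nc_scale (- 1) Q" by (rule ncfps_eqI) simp
  then show ?thesis using assms by (metis conv_series_add conv_series_scale)
qed

lemma conv_series_sum:
  "(\<And>x. x \<in> S \<Longrightarrow> F x \<in> conv_series v r) \<Longrightarrow> sum F S \<in> conv_series v r"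
  by (induction S rule: infinite_finite_induct) (auto simp: conv_series_0 conv_series_add)

lemma conv_series_polynomial:
  assumes "\<And>w. length w > m \<Longrightarrow> nc_coeff P w = 0"
  shows "P \<in> conv_series v r"
  unfolding conv_series_iff using assms by (auto intro!: exI[of _ "Suc m"])

text \<open>Long words contribute less than 1, and over a finite alphabet only finitely many words
  remain, which are bounded by their sum.\<close>

lemma conv_series_bounded:
  fixes P :: "('n::finite, 'k) ncfps"
  assumes "P \<in> conv_series v r"
  obtains B where "B > 0" "\<And>w. v (nc_coeff P w) * r ^ length w \<le> B"
proof -
  obtain N where N: "\<And>w. N \<le> length w \<Longrightarrow> v (nc_coeff P w) * r ^ length w < 1"
    using conv_seriesE[OF assms, of 1] by auto
  define B where "B = 1 + (\<Sum>w | length w \<le> N. v (nc_coeff P w) * r ^ length w)"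
  have nn: "0 \<le> v (nc_coeff P w) * r ^ length w" for w using r_pos v_nonneg by simp
  have "(\<Sum>w | length w \<le> N. v (nc_coeff P w) * r ^ length w) \<ge> 0" by (intro sum_nonneg nn)
  moreover have "v (nc_coeff P w) * r ^ length w \<le> (\<Sum>w | length w \<le> N. v (nc_coeff P w) * r ^ length w)"
    if "length w \<le> N" for w
    using that nn by (intro member_le_sum) auto
  ultimately have "B > 0" "v (nc_coeff P w) * r ^ length w \<le> B" for w
    using N[of w] by (auto simp: B_def) (smt (verit) nle_le)
  then show ?thesis using that by blast
qed

lemma conv_series_mult:
  fixes P :: "('n::finite, 'k) ncfps"
  assumes P: "P \<in> conv_series v r" and Q: "Q \<in> conv_series v r"
  shows "P * Q \<in> conv_series v r"
  unfolding conv_series_iff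
proof (intro allI impI)
  fix e :: real assume e: "e > 0"
  obtain B where B: "B > 0" "\<And>w. v (nc_coeff P w) * r ^ length w \<le> B"
    using conv_series_bounded[OF P] by blast
  obtain D where D: "D > 0" "\<And>w. v (nc_coeff Q w) * r ^ length w \<le> D"
    using conv_series_bounded[OF Q] by blast
  \<comment> \<open>The threshold uses \<open>e / 2\<close> because \<open>v_sum_le\<close> returns
    a nonstrict bound.\<close>
  obtain N1 where N1: "\<And>w. N1 \<le> length w \<Longrightarrow> v (nc_coeff P w) * r ^ length w < e / 2 / D"
    using conv_seriesE[OF P, of "e / 2 / D"] e D by auto
  obtain N2 where N2: "\<And>w. N2 \<le> length w \<Longrightarrow> v (nc_coeff Q w) * r ^ length w < e / 2 / B"
    using conv_seriesE[OF Q, of "e / 2 / B"] e B by auto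
  have nn: "0 \<le> v (nc_coeff R w) * r ^ length w" for R and w :: "'n list" using r_pos v_nonneg by simp
  have "v (nc_coeff (P * Q) w) * r ^ length w < e" if w: "N1 + N2 \<le> length w" for w
  proof -
    have "v (nc_coeff (P * Q) w) \<le> e / 2 / r ^ length w"
      unfolding nc_coeff_mult
    proof (rule v_sum_le)
      fix k assume k: "k \<in> {..length w}"
      define a b where "a = v (nc_coeff P (take k w)) * r ^ length (take k w)"
        and "b = v (nc_coeff Q (drop k w)) * r ^ length (drop k w)"
      have "a * b \<le> e / 2"
      \<comment> \<open>A long word has a long prefix or a long suffix; that factor is small while
        the other stays bounded.\<close>
      proof (cases "N1 \<le> k")
        case True
        then have "a \<le> e / 2 / D" using N1[of "take k w"] k by (simp add: a_def less_imp_le)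
        then have "a * b \<le> e / 2 / D * D"
          using D(1) D(2)[of "drop k w"] nn[of Q "drop k w"] e unfolding b_def by (intro mult_mono) auto
        then show ?thesis using D by simp
      next
        case False
        then have "b \<le> e / 2 / B" using N2[of "drop k w"] w by (simp add: b_def less_imp_le)
        then have "a * b \<le> B * (e / 2 / B)"
          using B(1) B(2)[of "take k w"] nn[of Q "drop k w"] e unfolding a_def b_def by (intro mult_mono) auto
        then show ?thesis using B by simp
      qed
      moreover have "a * b = v (nc_coeff P (take k w) * nc_coeff Q (drop k w)) * r ^ length w"
        using k by (simp add: a_def b_def v_mult) (simp flip: power_add)
      ultimately show "v (nc_coeff P (take k w) * nc_coeff Q (drop k w)) \<le> e / 2 / r ^ length w"
        using r_pos by (simp add: field_simps)
    qed (use e r_pos in simp)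
    then have "v (nc_coeff (P * Q) w) * r ^ length w \<le> e / 2" using r_pos by (simp add: field_simps)
    then show ?thesis using e by linarith
  qed
  then show "\<exists>N. \<forall>w. N \<le> length w \<longrightarrow> v (nc_coeff (P * Q) w) * r ^ length w < e" by blast
qed

text \<open>Norm at most \<open>r\<close> bounds the coefficient at \<open>w\<close> by r to the
  power 1 - |w|. Convergence makes the supremum finite, so it really dominates every term.\<close>

lemma tuple_bound_End_op:
  fixes f :: "('n::finite, 'k) nc_tuple"
  assumes "f \<in> End_op v r"
  shows "tuple_bound (1 / r) f"
  unfolding tuple_bound_def nc_bound_def
proof (intro allI conjI impI)
  fix i and w :: "'n list"
  have fi: "f i \<in> conv_series v r" "nc_coeff (f i) [] = 0" "nc_norm v r (f i) \<le> r"
    using assms by (auto simp: End_op_def aug_ideal_def)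
  show "nc_coeff (f i) w = 0" if "length w < 1" using that fi by simp
  obtain B where "\<And>w. v (nc_coeff (f i) w) * r ^ length w \<le> B"
    using conv_series_bounded[OF fi(1)] by blast
  then have "v (nc_coeff (f i) w) * r ^ length w \<le> nc_norm v r (f i)"
    unfolding nc_norm_def by (intro cSUP_upper) (auto simp: bdd_above_def)
  then show "v (nc_coeff (f i) w) * (1 / r) ^ 1 \<le> (1 / r) ^ length w"
    using fi(3) r_pos by (simp add: field_simps)
qed

text \<open>The words of length at most \<open>N\<close> give a finite combination \<open>H\<close>
  of convergent series. The tail \<open>R\<close> is uniformly small because the product of
  \<open>f\<close> along \<open>I\<close> has norm at most r to the power |I|.\<close>

lemma conv_series_subst:
  fixes P :: "('n::finite, 'k) ncfps"
  assumes P: "P \<in> conv_series v r" and f: "f \<in> End_op v r"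
  shows "nc_subst P f \<in> conv_series v r"
  unfolding conv_series_iff
proof (intro allI impI)
  fix e :: real assume e: "e > 0"
  have conv: "prod_list (map f I) \<in> conv_series v r" for I
  proof (induction I)
    case Nil
    then show ?case by (auto intro!: conv_series_polynomial[of 0])
  next
    case (Cons i I)
    then show ?case using f by (auto intro!: conv_series_mult simp: End_op_def aug_ideal_def)
  qed
  obtain N where N: "\<And>w. N \<le> length w \<Longrightarrow> v (nc_coeff P w) * r ^ length w < e / 2"
    using conv_seriesE[OF P, of "e / 2"] e by auto
  define H where "H = (\<Sum>I | length I \<le> N. nc_scale (nc_coeff P I) (prod_list (map f I)))"
  have "H \<in> conv_series v r" unfolding H_def by (intro conv_series_sum conv_series_scale conv)
  then obtain M where M: "\<And>w. M \<le> length w \<Longrightarrow> v (nc_coeff H w) * r ^ length w < e"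
    using conv_seriesE e by blast
  have "v (nc_coeff (nc_subst P f) w) * r ^ length w < e" if w: "max M N \<le> length w" for w
  proof -
    define R where "R = (\<Sum>I \<in> {I. length I \<le> length w} - {I. length I \<le> N}.
        nc_coeff P I * nc_coeff (prod_list (map f I)) w)"
    have "nc_coeff (nc_subst P f) w = R + nc_coeff H w"
      using w unfolding nc_coeff_subst R_def H_def nc_coeff_sum
      by (subst sum.subset_diff[of "{I. length I \<le> N}"]) auto
    then have "v (nc_coeff (nc_subst P f) w) \<le> max (v R) (v (nc_coeff H w))"
      using v_ultrametric by simp
    moreover have "v R \<le> e / 2 / r ^ length w"
      unfolding R_def
    proof (rule v_sum_le)
      fix I :: "'n list"
      assume "I \<in> {I. length I \<le> length w} - {I. length I \<le> N}"
      then have I: "v (nc_coeff P I) * r ^ length I \<le> e / 2" using N[of I] by auto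
      have "v (nc_coeff (prod_list (map f I)) w) * (1 / r) ^ length I \<le> (1 / r) ^ length w"
        using nc_bound_word_prod[OF tuple_bound_End_op[OF f], of I] r_pos by (simp add: nc_bound_def)
      then have *: "v (nc_coeff (prod_list (map f I)) w) * r ^ length w \<le> r ^ length I"
        using r_pos by (simp add: field_simps)
      have "v (nc_coeff P I) * (v (nc_coeff (prod_list (map f I)) w) * r ^ length w)
          \<le> v (nc_coeff P I) * r ^ length I"
        using * by (intro mult_left_mono v_nonneg)
      then have "v (nc_coeff P I) * (v (nc_coeff (prod_list (map f I)) w) * r ^ length w) \<le> e / 2"
        using I by linarith
      then show "v (nc_coeff P I * nc_coeff (prod_list (map f I)) w) \<le> e / 2 / r ^ length w"
        using r_pos by (simp add: v_mult field_simps)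
    qed (use e r_pos in simp)
    then have "v R * r ^ length w < e" using r_pos e by (simp add: field_simps)
    moreover have "v (nc_coeff H w) * r ^ length w < e" using M w by simp
    ultimately show ?thesis
      using r_pos by (smt (verit) mult_right_mono zero_le_power)
  qed
  then show "\<exists>N. \<forall>w. N \<le> length w \<longrightarrow> v (nc_coeff (nc_subst P f) w) * r ^ length w < e" by blast
qed

lemma nc_coeff_var_mult:
  "nc_coeff (nc_var i * Q) w = (case w of [] \<Rightarrow> 0 | j # u \<Rightarrow> if j = i then nc_coeff Q u else 0)"
  for Q :: "('n, 'k) ncfps"
proof (cases w)
  case (Cons j u)
  have "nc_coeff (nc_var i :: ('n, 'k) ncfps) (take k w) * nc_coeff Q (drop k w) =
      (if k = 1 then if j = i then nc_coeff Q u else 0 else 0)"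
    if "k \<le> length w" for k
  proof (cases "k = 1")
    case False
    then have "take k w \<noteq> [i]" using that by (auto dest: arg_cong[where f = length])
    then show ?thesis using False by simp
  qed (use Cons in auto)
  then have "nc_coeff (nc_var i * Q) w =
      (\<Sum>k\<le>length w. if k = 1 then if j = i then nc_coeff Q u else 0 else 0)"
    by (simp add: nc_coeff_mult del: nc_coeff_simps)
  also have "\<dots> = (if 1 \<le> length w then if j = i then nc_coeff Q u else 0 else 0)"
    by (simp add: sum.delta)
  finally show ?thesis using Cons by simp
qed (simp add: nc_coeff_mult)

text \<open>Identifies the ideal power with a condition on orders. For the converse, splitting off
  the first letter writes P as the finite sum of \<open>nc_var i * Q i\<close>, with
  \<open>Q i\<close> of order one less.\<close>

lemma aug_ideal_power_iff:
  fixes P :: "('n::finite, 'k) ncfps"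
  shows "P \<in> aug_ideal_power v r m \<longleftrightarrow>
    P \<in> conv_series v r \<and> (\<forall>w. length w < m \<longrightarrow> nc_coeff P w = 0)"
proof (induction m arbitrary: P)
  case (Suc m)
  show ?case
  proof
    assume "P \<in> aug_ideal_power v r (Suc m)"
    then obtain N :: nat and a b where P: "P = (\<Sum>k<N. a k * b k)"
      and ab: "\<And>k. k < N \<Longrightarrow> a k \<in> aug_ideal v r \<and> b k \<in> aug_ideal_power v r m" by auto
    have "P \<in> conv_series v r"
      unfolding P using ab Suc by (auto intro!: conv_series_sum conv_series_mult simp: aug_ideal_def)
    moreover have "nc_coeff (a k) (take j w) * nc_coeff (b k) (drop j w) = 0"
      if "length w < Suc m" "k < N" "j \<le> length w" for w k j
      using ab[OF that(2)] Suc that by (cases "j = 0") (auto simp: aug_ideal_def)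
    ultimately show "P \<in> conv_series v r \<and> (\<forall>w. length w < Suc m \<longrightarrow> nc_coeff P w = 0)"
      unfolding P by (auto simp: nc_coeff_sum nc_coeff_mult simp del: mult_eq_0_iff intro!: sum.neutral)
  next
    assume P: "P \<in> conv_series v r \<and> (\<forall>w. length w < Suc m \<longrightarrow> nc_coeff P w = 0)"
    \<comment> \<open>The sums in \<open>aug_ideal_power\<close> run over natural numbers, so the
      alphabet is enumerated.\<close>
    obtain h where h: "bij_betw h {0..<CARD('n)} (UNIV :: 'n set)"
      using ex_bij_betw_nat_finite[of "UNIV :: 'n set"] by auto
    define Q where "Q = (\<lambda>i. Abs_ncfps (\<lambda>w. nc_coeff P (i # w)))"
    have "Q i \<in> conv_series v r" for i
      unfolding conv_series_iff
    proof (intro allI impI)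
      fix e :: real assume "e > 0"
      \<comment> \<open>The factor \<open>r\<close> pays for the removed letter.\<close>
      then obtain N where N: "\<And>w. N \<le> length w \<Longrightarrow> v (nc_coeff P w) * r ^ length w < e * r"
        using P conv_seriesE[of P "e * r"] r_pos by auto
      have "v (nc_coeff (Q i) w) * r ^ length w < e" if "N \<le> length w" for w
        using N[of "i # w"] that r_pos by (simp add: Q_def mult_ac)
      then show "\<exists>N. \<forall>w. N \<le> length w \<longrightarrow> v (nc_coeff (Q i) w) * r ^ length w < e" by blast
    qed
    then have Q: "Q i \<in> aug_ideal_power v r m" for i
      using P Suc by (simp add: Q_def)
    have var: "nc_var i \<in> aug_ideal v r" for i :: 'n
      by (auto simp: aug_ideal_def intro!: conv_series_polynomial[of 1])
    have "P = (\<Sum>i\<in>UNIV. nc_var i * Q i)"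
    proof (rule ncfps_eqI)
      fix w
      show "nc_coeff P w = nc_coeff (\<Sum>i\<in>UNIV. nc_var i * Q i) w"
        using P by (cases w) (simp_all add: nc_coeff_sum nc_coeff_var_mult Q_def)
    qed
    also have "\<dots> = (\<Sum>k<CARD('n). nc_var (h k) * Q (h k))"
      using sum.reindex_bij_betw[OF h, of "\<lambda>i. nc_var i * Q i"] by (simp add: atLeast0LessThan)
    finally have "P = (\<Sum>k<CARD('n). nc_var (h k) * Q (h k))" .
    then show "P \<in> aug_ideal_power v r (Suc m)"
      using var Q unfolding aug_ideal_power.simps mem_Collect_eq
      by (intro exI[of _ "CARD('n)"] exI[of _ "\<lambda>k. nc_var (h k)"] exI[of _ "\<lambda>k. Q (h k)"]) auto
  qed
qed simp

end


section \<open>Semisimplicity\<close>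

definition subst_minus :: "('n::finite, 'k::ring_1) nc_tuple \<Rightarrow> 'k \<Rightarrow> ('n, 'k) ncfps \<Rightarrow> ('n, 'k) ncfps"
  where "subst_minus f a P = nc_subst P f - nc_scale a P"

lemma subst_minus_diff: "subst_minus f a (P - Q) = subst_minus f a P - subst_minus f a Q"
  by (rule ncfps_eqI) (simp add: subst_minus_def nc_subst_diff algebra_simps)

lemma subst_minus_add: "subst_minus f a (P + Q) = subst_minus f a P + subst_minus f a Q"
  by (rule ncfps_eqI) (simp add: subst_minus_def nc_subst_add algebra_simps)

lemma subst_minus_scale:
  fixes c :: "'k::comm_ring_1"
  shows "subst_minus f a (nc_scale c P) = nc_scale c (subst_minus f a P)"
  by (rule ncfps_eqI) (simp add: subst_minus_def nc_subst_scale algebra_simps)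

lemma subst_minus_subst:
  fixes a :: "'k::comm_ring_1"
  shows "subst_minus f a (nc_subst P f) = nc_subst (subst_minus f a P) f"
  by (rule ncfps_eqI) (simp add: subst_minus_def nc_subst_diff nc_subst_scale)

lemma nc_agree_subst_minus: "nc_agree m P Q \<Longrightarrow> nc_agree m (subst_minus f a P) (subst_minus f a Q)"
  using nc_agree_subst[of m P Q f] by (simp add: nc_agree_def subst_minus_def)

text \<open>A semisimple operator has no generalised eigenvectors. Let N be the operator minus
  \<open>a\<close>, U its kernel and U' an invariant complement. Writing P = R + Q along U and U',
  the vector NQ = NP lies in U' by invariance and in U since N kills NP, so it is 0.\<close>

lemma (in nonarchimedean_disc) semisimple_kernel:
  fixes f :: "('n::finite, 'k) nc_tuple"
  assumes ss: "nc_semisimple v r f" and f: "f \<in> End_op v r"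
    and NN: "nc_agree m (subst_minus f a (subst_minus f a P)) 0"
  shows "nc_agree m (subst_minus f a P) 0"
proof -
  \<comment> \<open>Agreement up to degree \<open>m\<close> is congruence modulo the ideal power
    \<open>Suc m\<close>.\<close>
  define W :: "('n, 'k) ncfps set" where "W = aug_ideal_power v r (Suc m)"
  define V where "V = (\<lambda>P. P +o W) ` conv_series v r"
  define sm where "sm = (\<lambda>c C. \<Union>P\<in>C. nc_scale c P +o W)"
  define T where "T = (\<lambda>C. \<Union>P\<in>C. nc_subst P f +o W)"
  let ?N = "subst_minus f a"
  have W_iff: "P \<in> W \<longleftrightarrow> P \<in> conv_series v r \<and> nc_agree m P 0" for P
    unfolding W_def aug_ideal_power_iff by (auto simp: nc_agree_def less_Suc_eq_le)
  have W0: "0 \<in> W" and Wd: "\<And>x y. x \<in> W \<Longrightarrow> y \<in> W \<Longrightarrow> x - y \<in> W"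
    by (auto simp: W_iff conv_series_0 conv_series_diff nc_agree_def)
  note coset = coset_eq_iff[OF W0 Wd] coset_add[OF W0 Wd] coset_mem_iff[OF W0 Wd]
  have W_sub: "x \<in> W \<Longrightarrow> nc_subst x f \<in> W" for x
    using nc_agree_subst[of m x 0 f]
    by (auto simp: W_iff conv_series_subst[OF _ f] nc_agree_def nc_coeff_subst)
  have W_sm: "x \<in> W \<Longrightarrow> nc_scale c x \<in> W" for x c
    by (auto simp: W_iff conv_series_scale nc_agree_def)
  \<comment> \<open>All representatives of a coset have the same image, so the union collapses to
    one coset.\<close>
  have T: "T (Q +o W) = nc_subst Q f +o W" for Q
  proof -
    have "nc_subst x f +o W = nc_subst Q f +o W" if "x \<in> Q +o W" for x
      using that W_sub[of "x - Q"] by (simp add: coset nc_subst_diff)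
    moreover have "Q \<in> Q +o W" by (simp add: coset W0)
    ultimately show ?thesis unfolding T_def by blast
  qed
  have sm: "sm c (Q +o W) = nc_scale c Q +o W" for c Q
  proof -
    have "nc_scale c x - nc_scale c Q = nc_scale c (x - Q)" for x
      by (rule ncfps_eqI) (simp add: algebra_simps)
    then have "nc_scale c x +o W = nc_scale c Q +o W" if "x \<in> Q +o W" for x
      using that W_sm[of "x - Q" c] by (simp add: coset)
    moreover have "Q \<in> Q +o W" by (simp add: coset W0)
    ultimately show ?thesis unfolding sm_def by blast
  qed
  have W_eq: "W = 0 +o W" by simp
  have N_conv: "Q \<in> conv_series v r \<Longrightarrow> ?N Q \<in> conv_series v r" for Q
    by (simp add: subst_minus_def conv_series_diff conv_series_subst[OF _ f] conv_series_scale)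
  have N_0: "?N 0 = 0" by (rule ncfps_eqI) (simp add: subst_minus_def nc_coeff_subst)
  have N_W: "x \<in> W \<Longrightarrow> ?N x \<in> W" for x
    using W_sub[of x] W_sm[of x a] by (simp add: subst_minus_def Wd)

  define U where "U = (\<lambda>P. P +o W) ` {Q \<in> conv_series v r. ?N Q \<in> W}"
  have U_iff: "Q +o W \<in> U \<longleftrightarrow> ?N Q \<in> W" if "Q \<in> conv_series v r" for Q
  proof
    assume "Q +o W \<in> U"
    then obtain R where R: "?N R \<in> W" "Q - R \<in> W" by (auto simp: U_def coset)
    \<comment> \<open>\<open>W\<close> is available as closed under differences, so sums are entered
      in this form.\<close>
    then have "?N (Q - R) - (0 - ?N R) \<in> W" using N_W Wd W0 by blast
    then show "?N Q \<in> W" by (simp add: subst_minus_diff)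
  qed (use that in \<open>auto simp: U_def\<close>)
  have U: "invariant_subspace V W (+) sm T U"
    unfolding invariant_subspace_def
  proof (intro conjI ballI allI)
    show "U \<subseteq> V" by (auto simp: U_def V_def)
    have "0 +o W \<in> U" using U_iff[of 0] by (simp add: conv_series_0 N_0 W0)
    then show "W \<in> U" by simp
  next
    fix C D assume "C \<in> U" "D \<in> U"
    then obtain Q R where QR: "Q \<in> conv_series v r" "R \<in> conv_series v r" "?N Q \<in> W" "?N R \<in> W"
      and CD: "C = Q +o W" "D = R +o W" by (auto simp: U_def)
    have "?N Q - (0 - ?N R) \<in> W" using QR Wd W0 by blast
    then show "C + D \<in> U" using QR
      by (simp add: CD coset U_iff conv_series_add subst_minus_add)
  next
    fix c C assume "C \<in> U"
    then obtain Q where Q: "Q \<in> conv_series v r" "?N Q \<in> W" "C = Q +o W" by (auto simp: U_def)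
    then show "sm c C \<in> U"
      by (simp add: sm U_iff conv_series_scale subst_minus_scale W_sm)
  next
    fix C assume "C \<in> U"
    then obtain Q where Q: "Q \<in> conv_series v r" "?N Q \<in> W" "C = Q +o W" by (auto simp: U_def)
    then show "T C \<in> U"
      by (simp add: T U_iff conv_series_subst[OF _ f] subst_minus_subst W_sub)
  qed
  have "semisimple_operator V W (+) sm T"
    using spec[OF ss[unfolded nc_semisimple_def Let_def], of "Suc m"]
    by (simp only: V_def W_def sm_def T_def)
  from this[unfolded semisimple_operator_def, rule_format, OF U]
  obtain U' where U': "invariant_subspace V W (+) sm T U'"
    and disj: "U \<inter> U' = {W}" and sum: "{x + y | x y. x \<in> U \<and> y \<in> U'} = V"
    by (elim exE conjE) (rule that)

  \<comment> \<open>P may diverge; its truncation is a polynomial, hence represents a class in the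
    quotient.\<close>
  define P0 where "P0 = Abs_ncfps (\<lambda>w. if length w \<le> m then nc_coeff P w else 0)"
  have P0: "nc_agree m P P0" by (simp add: P0_def nc_agree_def)
  have P0_conv: "P0 \<in> conv_series v r" by (rule conv_series_polynomial[of m]) (simp add: P0_def)
  have "P0 +o W \<in> V" using P0_conv by (simp add: V_def)
  then obtain C D where "C \<in> U" "D \<in> U'" "P0 +o W = C + D" unfolding sum[symmetric] by blast
  moreover from \<open>D \<in> U'\<close> U' obtain Q where "Q \<in> conv_series v r" "D = Q +o W"
    by (auto simp: invariant_subspace_def V_def)
  moreover from \<open>C \<in> U\<close> obtain R where "R \<in> conv_series v r" "?N R \<in> W" "C = R +o W"
    by (auto simp: U_def)
  ultimately have Q: "Q \<in> conv_series v r" "Q +o W \<in> U'" and R: "?N R \<in> W"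
    and PRQ: "P0 - (R + Q) \<in> W" by (simp_all add: coset)
  have "?N (P0 - (R + Q)) - (0 - ?N R) \<in> W" using N_W[OF PRQ] R Wd W0 by blast
  then have PQ: "?N P0 - ?N Q \<in> W" by (simp add: subst_minus_diff subst_minus_add)
  have "nc_agree m (?N (?N P0)) 0"
    using NN nc_agree_subst_minus[OF nc_agree_subst_minus[OF P0]] nc_agree_sym nc_agree_trans by blast
  then have "?N (?N P0) \<in> W" by (simp add: W_iff N_conv P0_conv)
  from Wd[OF this N_W[OF PQ]] have "?N (?N Q) \<in> W" by (simp add: subst_minus_diff)
  then have "?N Q +o W \<in> U" by (simp add: U_iff N_conv Q)
  moreover have "?N Q +o W \<in> U'"
  proof -
    have "?N Q = nc_subst Q f + nc_scale (- a) Q"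
      by (rule ncfps_eqI) (simp add: subst_minus_def)
    then have "?N Q +o W = T (Q +o W) + sm (- a) (Q +o W)" by (simp add: T sm coset)
    then show ?thesis using U' Q(2) by (simp add: invariant_subspace_def)
  qed
  ultimately have "?N Q +o W = 0 +o W" using disj by auto
  then have "?N Q \<in> W" by (simp only: coset) simp
  then have "?N P0 - (0 - ?N Q) - ?N Q \<in> W" using PQ Wd W0 by (metis add.commute diff_add_cancel diff_diff_eq2 diff_zero minus_diff_eq diff_0_right)
  then have "?N P0 \<in> W" by simp
  then show ?thesis
    using nc_agree_subst_minus[OF P0, of f a] nc_agree_trans W_iff by blast
qed


section \<open>The Newton step\<close>

definition nc_diag :: "('n \<Rightarrow> 'k::ring_1) \<Rightarrow> ('n, 'k) nc_tuple" where
  "nc_diag lam = (\<lambda>i. nc_scale (lam i) (nc_var i))"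

lemma pointed_diag [simp]: "pointed (nc_diag lam)"
  by (simp add: pointed_def nc_diag_def)

lemma nc_coeff_diag: "nc_coeff (nc_diag lam i) w = (if w = [i] then lam i else 0)"
  by (simp add: nc_diag_def)

lemma nc_linear_diag: "nc_linear (\<chi> i j. if i = j then lam i else 0) = nc_diag lam"
proof (intro ext ncfps_eqI)
  fix i w
  have "(if i = j then lam i else 0) * (if w = [j] then 1 else 0) = (if j = i then nc_coeff (nc_diag lam i) w else 0)"
    for j by (auto simp: nc_coeff_diag)
  then show "nc_coeff (nc_linear (\<chi> i j. if i = j then lam i else 0) i) w = nc_coeff (nc_diag lam i) w"
    by (simp add: nc_linear_def nc_coeff_sum)
qed

lemma nc_subst_0 [simp]: "nc_subst 0 f = 0"
  by (rule ncfps_eqI) (simp add: nc_coeff_subst)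

lemma word_eval_singleton [simp]: "word_eval lam [i] = lam i"
  by (simp add: word_eval_def)

text \<open>Scalars commute, so only letter counts matter; this links words to the exponents in
  Siegel's condition.\<close>

lemma word_eval_count:
  fixes lam :: "'n::finite \<Rightarrow> 'k::comm_ring_1"
  shows "word_eval lam w = (\<Prod>k\<in>UNIV. lam k ^ count_list w k)"
proof (induction w)
  case (Cons i w)
  have "(\<Prod>k\<in>UNIV. lam k ^ count_list (i # w) k)
      = (\<Prod>k\<in>UNIV. (if k = i then lam i else 1) * lam k ^ count_list w k)"
    by (rule prod.cong) auto
  also have "\<dots> = lam i * word_eval lam w"
    by (simp add: prod.distrib Cons.IH)
  finally show ?case by (simp add: word_eval_def)
qed (simp add: word_eval_def)

lemma unipotent_comp:
  fixes f g :: "('n::finite, 'k::comm_ring_1) nc_tuple"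
  assumes "unipotent f" "unipotent g"
  shows "unipotent (f \<circ>\<^sub>n\<^sub>c g)"
  unfolding unipotent_def nc_comp_def
proof
  fix i
  have "nc_agree 1 (nc_subst (f i) g) (nc_subst (nc_var i) g)"
    using assms(1) by (intro nc_agree_subst) (simp add: unipotent_def)
  also have "nc_subst (nc_var i) g = g i" by (rule nc_subst_var[OF unipotent_pointed[OF assms(2)]])
  finally show "nc_agree 1 (nc_subst (f i) g) (nc_var i)"
    using assms(2) nc_agree_trans unfolding unipotent_def by blast
qed

text \<open>Semisimplicity enters through the absence of generalised eigenvectors. Solving the
  nonresonant part of the linearised equation turns the \<open>i\<close>-th variable into a \<open>y\<close> such that
  \<open>subst_minus f' (lam i) y\<close> is, modulo degree \<open>2 * M\<close>, the resonant part \<open>R\<close> of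
  \<open>f' i\<close>, and \<open>R\<close> is itself annihilated. Conjugation transports this to \<open>f\<close>.\<close>

lemma resonant_coeff_eq_0:
  fixes f \<psi> \<eta> :: "('n::finite, 'k::field) nc_tuple"
  assumes kernel: "\<And>P a m. nc_agree m (subst_minus f a (subst_minus f a P)) 0
      \<Longrightarrow> nc_agree m (subst_minus f a P) 0"
    and p: "pointed f" "pointed \<psi>" "pointed \<eta>"
    and inv: "\<psi> \<circ>\<^sub>n\<^sub>c \<eta> = nc_var" "\<eta> \<circ>\<^sub>n\<^sub>c \<psi> = nc_var"
    and f': "f' = \<eta> \<circ>\<^sub>n\<^sub>c f \<circ>\<^sub>n\<^sub>c \<psi>" "\<And>i. nc_agree M (f' i) (nc_diag lam i)"
    and w: "1 \<le> M" "M < length w" "length w \<le> 2 * M" "word_eval lam w = lam i"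
  shows "nc_coeff (f' i) w = 0"
proof -
  \<comment> \<open>The nonresonant solution of the linearised equation, set to 0 where the divisor
    would vanish.\<close>
  define h where "h = Abs_ncfps (\<lambda>w. if M < length w \<and> length w \<le> 2 * M \<and> word_eval lam w \<noteq> lam i
    then nc_coeff (f' i) w / (word_eval lam w - lam i) else 0)"
  define R where "R = Abs_ncfps (\<lambda>w. if M < length w \<and> length w \<le> 2 * M \<and> word_eval lam w = lam i
    then nc_coeff (f' i) w else 0)"
  define y where "y = nc_var i - h"
  let ?N = "subst_minus f (lam i)" and ?N' = "subst_minus f' (lam i)"
  have pf': "pointed f'" using p by (simp add: f'(1))
  have comm: "f' \<circ>\<^sub>n\<^sub>c \<eta> = \<eta> \<circ>\<^sub>n\<^sub>c f" by (simp add: f'(1) nc_comp_assoc p inv)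
  have conj: "?N (nc_subst P \<eta>) = nc_subst (?N' P) \<eta>" for P
    by (simp add: subst_minus_def nc_subst_diff nc_subst_scale nc_subst_subst p pf' comm)
  \<comment> \<open>On series of order \<open>M + 1\<close>, replacing \<open>f'\<close> by its
    linear part is exact up to degree \<open>2 * M\<close>, since 2M < M + (M + 1).\<close>
  have diag: "nc_agree (2 * M) (nc_subst P f') (nc_subst P (nc_diag lam))"
    if "\<And>w. length w < M + 1 \<Longrightarrow> nc_coeff P w = 0" for P
    by (rule nc_agree_subst_order[OF pf' pointed_diag f'(2) that]) auto
  have "nc_agree (2 * M) (nc_subst h f') (nc_subst h (nc_diag lam))"
    by (rule diag) (simp add: h_def)
  then have Ny: "nc_agree (2 * M) (?N' y) R"
    using f'(2)[of i] w(1)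
    by (auto simp: nc_agree_def subst_minus_def y_def nc_subst_diff nc_subst_var pf' nc_coeff_diag
        nc_diag_def nc_coeff_subst_diag h_def R_def field_simps)
  have "nc_agree (2 * M) (nc_subst R f') (nc_subst R (nc_diag lam))"
    by (rule diag) (simp add: R_def)
  then have "nc_agree (2 * M) (?N' R) 0"
    by (auto simp: nc_agree_def subst_minus_def nc_diag_def nc_coeff_subst_diag R_def)
  then have "nc_agree (2 * M) (?N' (?N' y)) 0"
    using nc_agree_subst_minus[OF Ny] nc_agree_trans by blast
  then have "nc_agree (2 * M) (?N (?N (nc_subst y \<eta>))) 0"
    using nc_agree_subst[of "2 * M" _ 0 \<eta>] by (simp add: conj)
  \<comment> \<open>The kernel property is known for \<open>f\<close>, so it is used on the
    transported series.\<close>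
  then have "nc_agree (2 * M) (nc_subst (?N' y) \<eta>) 0"
    using kernel by (simp flip: conj)
  then have "nc_agree (2 * M) (nc_subst R \<eta>) 0"
    using nc_agree_subst[OF Ny, of \<eta>] nc_agree_sym nc_agree_trans by blast
  then have "nc_agree (2 * M) R 0"
    using nc_agree_subst[of "2 * M" "nc_subst R \<eta>" 0 \<psi>] by (simp add: nc_subst_subst p inv)
  then show ?thesis using w by (auto simp: nc_agree_def R_def)
qed

context nonarchimedean_abs
begin

text \<open>Put \<phi> = x + h and f = D + g with D diagonal. Since g has order above M and \<phi>
  agrees with x up to M, g(\<phi>) equals g up to degree 2M. The equation becomes g + D(\<phi>) =
  \<phi>(D), which is linear in h and solved by dividing by
  \<open>word_eval lam w - lam i\<close>.\<close>

lemma newton_step: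
  fixes f :: "('n::finite, 'k) nc_tuple"
  assumes f: "tuple_bound C f" "\<And>i. nc_agree M (f i) (nc_diag lam i)"
    and C: "C > 0" and a: "a \<ge> 1" and M: "1 \<le> M"
    and res: "\<And>i w. M < length w \<Longrightarrow> length w \<le> 2 * M \<Longrightarrow> word_eval lam w = lam i \<Longrightarrow>
        nc_coeff (f i) w = 0"
    and nonres: "\<And>i w. M < length w \<Longrightarrow> length w \<le> 2 * M \<Longrightarrow> word_eval lam w \<noteq> lam i \<Longrightarrow>
        1 \<le> v (word_eval lam w - lam i) * a ^ M"
  obtains \<phi> where "tuple_bound (C * a) \<phi>" "\<And>i. nc_agree M (\<phi> i) (nc_var i)"
    "\<And>i. nc_agree (2 * M) ((f \<circ>\<^sub>n\<^sub>c \<phi>) i) ((\<phi> \<circ>\<^sub>n\<^sub>c nc_diag lam) i)"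
proof
  define h where "h = (\<lambda>i. Abs_ncfps (\<lambda>w.
    if M < length w \<and> length w \<le> 2 * M \<and> word_eval lam w \<noteq> lam i
    then nc_coeff (f i) w / (word_eval lam w - lam i) else 0))"
  define \<phi> where "\<phi> = (\<lambda>i. nc_var i + h i)"
  have Ca: "C * a > 0" using C a by simp
  show agree: "nc_agree M (\<phi> i) (nc_var i)" for i
    by (simp add: nc_agree_def \<phi>_def h_def)
  have h_bound: "v (nc_coeff (h i) w) * (C * a) \<le> (C * a) ^ length w" for i w
  proof (cases "M < length w \<and> length w \<le> 2 * M \<and> word_eval lam w \<noteq> lam i")
    case True
    define d where "d = v (word_eval lam w - lam i)"
    have d: "1 \<le> d * a ^ M" using nonres True by (simp add: d_def)
    then have "d > 0" using v_nonneg[of "word_eval lam w - lam i"] by (cases "d = 0") (auto simp: d_def)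
    have "v (nc_coeff (h i) w) = v (nc_coeff (f i) w) / d"
      using True by (simp add: h_def v_divide d_def)
    also have "\<dots> \<le> v (nc_coeff (f i) w) * a ^ M"
      using mult_left_mono[OF d v_nonneg, of "nc_coeff (f i) w"] \<open>d > 0\<close> by (simp add: field_simps)
    finally have "v (nc_coeff (h i) w) * (C * a) \<le> v (nc_coeff (f i) w) * a ^ M * (C * a)"
      using Ca by (intro mult_right_mono) auto
    also have "\<dots> = (v (nc_coeff (f i) w) * C) * a ^ Suc M" by simp
    \<comment> \<open>As \<open>M < length w\<close>, the loss \<open>a ^ M\<close> from the divisor
      is absorbed by enlarging \<open>C\<close> to \<open>C * a\<close>.\<close>
    also have "\<dots> \<le> C ^ length w * a ^ length w"
      using f(1) True a C by (intro mult_mono power_increasing) (auto simp: tuple_bound_def nc_bound_def)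
    finally show ?thesis by (simp add: power_mult_distrib)
  next
    case False
    then show ?thesis using Ca by (simp add: h_def)
  qed
  show "tuple_bound (C * a) \<phi>"
    unfolding tuple_bound_def nc_bound_def
  proof (intro allI conjI impI)
    fix i and w :: "'n list"
    show "nc_coeff (\<phi> i) w = 0" if "length w < 1" using that by (simp add: \<phi>_def h_def)
    show "v (nc_coeff (\<phi> i) w) * (C * a) ^ 1 \<le> (C * a) ^ length w"
    proof (cases "w = [i]")
      case True
      then show ?thesis using M by (simp add: \<phi>_def h_def)
    next
      case False
      then show ?thesis using h_bound[of i w] by (simp add: \<phi>_def)
    qed
  qed
  have p: "pointed \<phi>" by (simp add: pointed_def \<phi>_def h_def)
  show "nc_agree (2 * M) ((f \<circ>\<^sub>n\<^sub>c \<phi>) i) ((\<phi> \<circ>\<^sub>n\<^sub>c nc_diag lam) i)" for i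
  proof -
    define g where "g = f i - nc_diag lam i"
    have fi: "f i = nc_diag lam i + g" by (simp add: g_def)
    have g0: "nc_coeff g w = 0" if "length w < M + 1" for w
      using f(2)[of i] that by (simp add: nc_agree_def g_def)
    have "nc_agree (2 * M) (nc_subst g \<phi>) (nc_subst g nc_var)"
      by (rule nc_agree_subst_order[OF p pointed_var agree g0]) auto
    then have sub: "nc_coeff (nc_subst g \<phi>) w = nc_coeff g w" if "length w \<le> 2 * M" for w
      using that by (simp add: nc_agree_def)
    have diag: "nc_subst (nc_diag lam i) \<phi> = nc_scale (lam i) (\<phi> i)"
      by (simp add: nc_diag_def nc_subst_scale nc_subst_var p)
    show ?thesis
      unfolding nc_agree_def
    proof (intro allI impI)
      fix w :: "'n list" assume w: "length w \<le> 2 * M"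
      have "nc_coeff ((f \<circ>\<^sub>n\<^sub>c \<phi>) i) w = nc_coeff g w + lam i * nc_coeff (\<phi> i) w"
        by (simp add: nc_comp_def fi nc_subst_add diag sub w)
      \<comment> \<open>Above degree M this is the equation defining \<open>h\<close>, or
        \<open>res\<close> at resonant words; up to degree M only \<open>[i]\<close> survives, with
        value \<open>lam i\<close> on both sides.\<close>
      also have "\<dots> = nc_coeff (\<phi> i) w * word_eval lam w"
      proof (cases "M < length w")
        case True
        then have "w \<noteq> [i]" using M by auto
        then show ?thesis
          using True w res[of w i] by (auto simp: g_def \<phi>_def h_def nc_coeff_diag field_simps)
      next
        case False
        then show ?thesis using g0[of w] by (auto simp: \<phi>_def h_def)
      qed
      finally show "nc_coeff ((f \<circ>\<^sub>n\<^sub>c \<phi>) i) w = nc_coeff ((\<phi> \<circ>\<^sub>n\<^sub>c nc_diag lam) i) w"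
        by (simp add: nc_comp_def nc_diag_def nc_coeff_subst_diag)
    qed
  qed
qed

end


section \<open>Convergence of the iteration\<close>

lemma nc_agree_dyadic:
  assumes "\<And>s. nc_agree (2 ^ s) (P (Suc s)) (P s)" "s \<le> t"
  shows "nc_agree (2 ^ s) (P t) (P s)"
  using assms(2)
proof (induction t rule: dec_induct)
  case (step t)
  have "nc_agree (2 ^ s) (P (Suc t)) (P t)"
    by (rule nc_agree_mono[OF assms(1)]) (use step in simp)
  then show ?case using step nc_agree_trans by blast
qed simp

context nonarchimedean_abs
begin

text \<open>The next iterate is \<psi> composed with the Newton correction of the conjugate of
  \<open>f\<close>. Constants multiply to at most \<open>D\<close>, and coefficients stabilise
  because corrections start in ever higher degrees.\<close>

lemma newton_limit:
  fixes f :: "('n::finite, 'k) nc_tuple" and C a :: "nat \<Rightarrow> real"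
  assumes kernel: "\<And>P a m. nc_agree m (subst_minus f a (subst_minus f a P)) 0
      \<Longrightarrow> nc_agree m (subst_minus f a P) 0"
    and f: "tuple_bound (C 0) f" "\<And>i. nc_agree 1 (f i) (nc_diag lam i)"
    and C: "C 0 > 0" "\<And>s. C (Suc s) = C s * a s" "\<And>s. C s \<le> D"
    and a: "\<And>s. a s \<ge> 1"
    and nonres: "\<And>s i w. 2 ^ s < length w \<Longrightarrow> length w \<le> 2 * 2 ^ s \<Longrightarrow> word_eval lam w \<noteq> lam i \<Longrightarrow>
        1 \<le> v (word_eval lam w - lam i) * a s ^ (2 ^ s)"
  obtains \<psi> where "unipotent \<psi>" "tuple_bound D \<psi>" "f \<circ>\<^sub>n\<^sub>c \<psi> = \<psi> \<circ>\<^sub>n\<^sub>c nc_diag lam"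
proof -
  define Q where "Q = (\<lambda>s \<psi>. unipotent \<psi> \<and> tuple_bound (C s) \<psi> \<and>
    (\<forall>i. nc_agree (2 ^ s) ((f \<circ>\<^sub>n\<^sub>c \<psi>) i) ((\<psi> \<circ>\<^sub>n\<^sub>c nc_diag lam) i)))"
  have C_pos: "C s > 0" and C_ge: "C 0 \<le> C s" for s
  proof (induction s)
    case (Suc s)
    case 1
    then show ?case using Suc a[of s] by (simp add: C)
    case 2
    have "C s * 1 \<le> C s * a s" using Suc a[of s] by (intro mult_left_mono) auto
    then show ?case using Suc unfolding C(2) by linarith
  qed (use C in auto)
  have pf: "pointed f" by (rule tuple_bound_pointed[OF f(1)])
  have "\<exists>\<psi>. \<forall>s. Q s (\<psi> s) \<and> (\<forall>i. nc_agree (2 ^ s) (\<psi> (Suc s) i) (\<psi> s i))"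
  proof (rule dependent_nat_choice)
    \<comment> \<open>The identity serves at stage 0, where \<open>2 ^ 0 = 1\<close> concerns only
      the linear part of \<open>f\<close>.\<close>
    show "\<exists>\<psi>. Q 0 \<psi>"
      by (rule exI[of _ nc_var]) (use f C in \<open>auto simp: Q_def unipotent_def\<close>)
  next
    fix \<psi> s assume Q: "Q s \<psi>"
    define \<eta> where "\<eta> = left_inverse \<psi>"
    have u: "unipotent \<psi>" and b: "tuple_bound (C s) \<psi>"
      and agree: "\<And>i. nc_agree (2 ^ s) ((f \<circ>\<^sub>n\<^sub>c \<psi>) i) ((\<psi> \<circ>\<^sub>n\<^sub>c nc_diag lam) i)"
      using Q by (auto simp: Q_def)
    have b': "tuple_bound (C s) \<eta>" unfolding \<eta>_def by (rule tuple_bound_left_inverse[OF b C_pos])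
    note p = pf unipotent_pointed[OF u] tuple_bound_pointed[OF b']
    have inv: "\<psi> \<circ>\<^sub>n\<^sub>c \<eta> = nc_var" "\<eta> \<circ>\<^sub>n\<^sub>c \<psi> = nc_var"
      by (simp_all add: \<eta>_def left_inverse_comp comp_left_inverse u)
    \<comment> \<open>The conjugate keeps the constant \<open>C s\<close>, so one stage costs the
      factor \<open>a s\<close> only.\<close>
    define f' where "f' = \<eta> \<circ>\<^sub>n\<^sub>c f \<circ>\<^sub>n\<^sub>c \<psi>"
    have f'_bound: "tuple_bound (C s) f'"
      unfolding f'_def
      by (intro tuple_bound_comp b b' tuple_bound_mono[OF f(1)] C C_pos C_ge)
    have f'_agree: "nc_agree (2 ^ s) (f' i) (nc_diag lam i)" for i
    proof -
      have "nc_agree (2 ^ s) (nc_subst (\<eta> i) (f \<circ>\<^sub>n\<^sub>c \<psi>)) (nc_subst (\<eta> i) (\<psi> \<circ>\<^sub>n\<^sub>c nc_diag lam))"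
        by (rule nc_agree_subst_right) (rule agree)
      moreover have "nc_subst (\<eta> i) (f \<circ>\<^sub>n\<^sub>c \<psi>) = f' i"
        using nc_comp_assoc[OF p(1,2), of \<eta>] by (simp add: f'_def nc_comp_def fun_eq_iff)
      moreover have "nc_subst (\<eta> i) (\<psi> \<circ>\<^sub>n\<^sub>c nc_diag lam) = nc_diag lam i"
        using nc_comp_assoc[OF p(2) pointed_diag, of \<eta> lam] nc_comp_var_left[of "nc_diag lam"]
        by (simp add: inv) (simp add: nc_comp_def fun_eq_iff)
      ultimately show ?thesis by simp
    qed
    obtain \<phi> where \<phi>: "tuple_bound (C s * a s) \<phi>" "\<And>i. nc_agree (2 ^ s) (\<phi> i) (nc_var i)"
      "\<And>i. nc_agree (2 * 2 ^ s) ((f' \<circ>\<^sub>n\<^sub>c \<phi>) i) ((\<phi> \<circ>\<^sub>n\<^sub>c nc_diag lam) i)"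
    proof (rule newton_step[OF f'_bound f'_agree C_pos a _ _ nonres])
      show "nc_coeff (f' i) w = 0"
        if "2 ^ s < length w" "length w \<le> 2 * 2 ^ s" "word_eval lam w = lam i" for i w
        by (rule resonant_coeff_eq_0[OF kernel p inv f'_def f'_agree _ that]) auto
    qed auto
    note p\<phi> = tuple_bound_pointed[OF \<phi>(1)]
    have u\<phi>: "unipotent \<phi>"
      unfolding unipotent_def using nc_agree_mono[OF \<phi>(2)] by auto
    have "Q (Suc s) (\<psi> \<circ>\<^sub>n\<^sub>c \<phi>)"
      unfolding Q_def
    proof (intro conjI allI)
      show "unipotent (\<psi> \<circ>\<^sub>n\<^sub>c \<phi>)" by (rule unipotent_comp[OF u u\<phi>])
      have "tuple_bound (C (Suc s)) \<psi>"
        using b C_pos a[of s] by (rule_tac tuple_bound_mono) (auto simp: C)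
      then show "tuple_bound (C (Suc s)) (\<psi> \<circ>\<^sub>n\<^sub>c \<phi>)"
        using \<phi>(1) C_pos[of "Suc s"] by (intro tuple_bound_comp) (auto simp: C)
      fix i
      have "f \<circ>\<^sub>n\<^sub>c \<psi> = \<psi> \<circ>\<^sub>n\<^sub>c f'"
        by (simp add: f'_def nc_comp_assoc p inv flip: nc_comp_assoc[of _ _ \<psi>])
      then have "f \<circ>\<^sub>n\<^sub>c (\<psi> \<circ>\<^sub>n\<^sub>c \<phi>) = \<psi> \<circ>\<^sub>n\<^sub>c (f' \<circ>\<^sub>n\<^sub>c \<phi>)"
        using p p\<phi> tuple_bound_pointed[OF f'_bound] by (simp flip: nc_comp_assoc)
      moreover have "nc_agree (2 ^ Suc s) ((\<psi> \<circ>\<^sub>n\<^sub>c (f' \<circ>\<^sub>n\<^sub>c \<phi>)) i) ((\<psi> \<circ>\<^sub>n\<^sub>c (\<phi> \<circ>\<^sub>n\<^sub>c nc_diag lam)) i)"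
        unfolding nc_comp_def[of \<psi>] by (rule nc_agree_subst_right) (use \<phi>(3) in simp)
      ultimately show "nc_agree (2 ^ Suc s) ((f \<circ>\<^sub>n\<^sub>c (\<psi> \<circ>\<^sub>n\<^sub>c \<phi>)) i) ((\<psi> \<circ>\<^sub>n\<^sub>c \<phi> \<circ>\<^sub>n\<^sub>c nc_diag lam) i)"
        by (simp add: nc_comp_assoc p\<phi>)
    qed
    moreover have "nc_agree (2 ^ s) ((\<psi> \<circ>\<^sub>n\<^sub>c \<phi>) i) (\<psi> i)" for i
      using nc_agree_subst_right[of "2 ^ s" \<phi> nc_var "\<psi> i"] \<phi>(2) by (simp add: nc_comp_def)
    ultimately show "\<exists>\<psi>'. Q (Suc s) \<psi>' \<and> (\<forall>i. nc_agree (2 ^ s) (\<psi>' i) (\<psi> i))" by blast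
  qed
  then obtain \<psi> where Q: "\<And>s. Q s (\<psi> s)"
    and step: "\<And>s i. nc_agree (2 ^ s) (\<psi> (Suc s) i) (\<psi> s i)" by blast
  have le: "s \<le> (2 :: nat) ^ s" for s by (simp add: less_imp_le)
  \<comment> \<open>The coefficient at \<open>w\<close> no longer changes from stage
    \<open>length w\<close> on, since \<open>length w \<le> 2 ^ length w\<close>.\<close>
  define \<Psi> where "\<Psi> = (\<lambda>i. Abs_ncfps (\<lambda>w. nc_coeff (\<psi> (length w) i) w))"
  have \<Psi>: "nc_agree s (\<Psi> i) (\<psi> s i)" for s i
    unfolding nc_agree_def
  proof (intro allI impI)
    fix w :: "'n list" assume "length w \<le> s"
    then have "nc_agree (2 ^ length w) (\<psi> s i) (\<psi> (length w) i)"
      using nc_agree_dyadic[of "\<lambda>s. \<psi> s i"] step by blast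
    then show "nc_coeff (\<Psi> i) w = nc_coeff (\<psi> s i) w"
      using le[of "length w"] by (simp add: nc_agree_def \<Psi>_def)
  qed
  show ?thesis
  proof (rule that)
    have "unipotent (\<psi> 1)" using Q by (simp add: Q_def)
    then show "unipotent \<Psi>"
      unfolding unipotent_def using \<Psi>[of 1] nc_agree_trans by blast
    have "tuple_bound D (\<psi> s)" for s
      using Q[of s] C_pos[of s] C(3)[of s] by (auto simp: Q_def intro: tuple_bound_mono)
    then show "tuple_bound D \<Psi>"
      by (auto simp: tuple_bound_def nc_bound_def \<Psi>_def)
    show "f \<circ>\<^sub>n\<^sub>c \<Psi> = \<Psi> \<circ>\<^sub>n\<^sub>c nc_diag lam"
    proof (intro ext ncfps_eqI)
      fix i and w :: "'n list"
      let ?n = "length w"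
      have "nc_agree ?n ((f \<circ>\<^sub>n\<^sub>c \<Psi>) i) ((f \<circ>\<^sub>n\<^sub>c \<psi> ?n) i)"
        unfolding nc_comp_def by (intro nc_agree_subst_right \<Psi>)
      moreover have "nc_agree ?n ((f \<circ>\<^sub>n\<^sub>c \<psi> ?n) i) ((\<psi> ?n \<circ>\<^sub>n\<^sub>c nc_diag lam) i)"
        using Q[of ?n] le[of ?n] by (auto simp: Q_def intro: nc_agree_mono)
      moreover have "nc_agree ?n ((\<psi> ?n \<circ>\<^sub>n\<^sub>c nc_diag lam) i) ((\<Psi> \<circ>\<^sub>n\<^sub>c nc_diag lam) i)"
        unfolding nc_comp_def by (intro nc_agree_subst nc_agree_sym[OF \<Psi>])
      ultimately show "nc_coeff ((f \<circ>\<^sub>n\<^sub>c \<Psi>) i) w = nc_coeff ((\<Psi> \<circ>\<^sub>n\<^sub>c nc_diag lam) i) w"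
        by (simp add: nc_agree_def)
    qed
  qed
qed

text \<open>Halving the radius \<open>1 / C\<close> leaves a factor 2 to the power -|w|: it forces
  decay, and on nonempty words it offsets the factor 2 in \<open>2 * r\<close>.\<close>

lemma tuple_bound_in_End_op:
  fixes f :: "('n, 'k) nc_tuple"
  assumes f: "tuple_bound C f" and C: "C > 0"
  shows "f \<in> End_op v (1 / (2 * C))"
proof -
  define r where "r = 1 / (2 * C)"
  have r: "r > 0" using C by (simp add: r_def)
  interpret nonarchimedean_disc v r by unfold_locales (rule r)
  have bound: "v (nc_coeff (f i) w) * r ^ length w \<le> 2 * r * (1 / 2) ^ length w" for i w
  proof -
    have "v (nc_coeff (f i) w) * C \<le> C ^ length w" using f by (simp add: tuple_bound_def nc_bound_def)
    then have "v (nc_coeff (f i) w) * C * r ^ length w \<le> C ^ length w * r ^ length w"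
      using r by (intro mult_right_mono) auto
    also have "\<dots> = (1 / 2) ^ length w" using C by (simp add: r_def flip: power_mult_distrib)
    finally show ?thesis using C by (simp add: r_def field_simps)
  qed
  have "f i \<in> aug_ideal v r \<and> nc_norm v r (f i) \<le> r" for i
  proof
    have "f i \<in> conv_series v r"
      unfolding conv_series_iff
    proof (intro allI impI)
      fix e :: real assume "e > 0"
      then obtain N where N: "(1 / 2) ^ N < e / (2 * r)"
        using real_arch_pow_inv[of "e / (2 * r)" "1 / 2"] r by auto
      have "v (nc_coeff (f i) w) * r ^ length w < e" if "N \<le> length w" for w
      proof -
        have "(1 / 2) ^ length w \<le> ((1 / 2) ^ N :: real)" using that by (intro power_decreasing) auto
        then have "2 * r * (1 / 2) ^ length w \<le> 2 * r * (1 / 2) ^ N" using r by simp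
        also have "\<dots> < e" using N r by (simp add: field_simps)
        finally show ?thesis using bound[of i w] by linarith
      qed
      then show "\<exists>N. \<forall>w. N \<le> length w \<longrightarrow> v (nc_coeff (f i) w) * r ^ length w < e" by blast
    qed
    then show "f i \<in> aug_ideal v r"
      using tuple_bound_pointed[OF f] by (simp add: aug_ideal_def pointed_def)
    show "nc_norm v r (f i) \<le> r"
      unfolding nc_norm_def
    proof (rule cSUP_least)
      fix w :: "'n list"
      show "v (nc_coeff (f i) w) * r ^ length w \<le> r"
      proof (cases w)
        case Nil
        then show ?thesis using tuple_bound_pointed[OF f] r by (simp add: pointed_def)
      next
        case (Cons j u)
        have "2 * r * (1 / 2) ^ length w \<le> r"
          using Cons r by (simp add: power_le_one)
        then show ?thesis using bound[of i w] by linarith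
      qed
    qed simp
  qed
  then show ?thesis by (auto simp: End_op_def r_def)
qed

end

section \<open>Small divisors and the choice of constants\<close>

lemma siegel_word_eval:
  fixes lam :: "'n::finite \<Rightarrow> 'k::field"
  assumes "siegel_condition v c \<mu> lam" "w \<noteq> []" "word_eval lam w \<noteq> lam i"
  shows "v (word_eval lam w - lam i) \<ge> c * (real (length w) / 2) powr (- \<mu>)"
  using assms(1)[unfolded siegel_condition_def, rule_format, of "length w" "count_list w" i] assms(2,3)
  by (simp add: word_eval_count sum_count_set Suc_le_eq)

theorem theorem3p2p1:
  fixes l :: nat
    and v :: "'k::field_char_0 \<Rightarrow> real"
    and r c \<mu> :: real
    and A :: "'k ^ 'n ^ 'n"
    and f fhat :: "('n::finite, 'k) nc_tuple"
    and lam :: "'n \<Rightarrow> 'k"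
  assumes K: "finite_extension_padic l v"
    and r: "0 < r" "r < 1"
    and f: "f \<in> End_op v r"
    and f_eq: "f = (\<lambda>i. nc_linear A i + fhat i)"
    and fhat: "eq_upto_O v r 2 fhat (\<lambda>i. 0)"
    and semisimple: "nc_semisimple v r f"
    and A_diagonal: "A = (\<chi> i j. if i = j then lam i else 0)"
    and siegel: "c > 0" "\<mu> > 0" "siegel_condition v c \<mu> lam"
    and abs_le_1: "\<forall>i. v (lam i) \<le> 1"
  shows "\<exists>rinf \<psi> \<psi>inv. 0 < rinf \<and> rinf < r \<and>
           inverse_in_End_op v rinf \<psi> \<psi>inv \<and>
           \<psi>inv \<circ>\<^sub>n\<^sub>c f \<circ>\<^sub>n\<^sub>c \<psi> = nc_linear A"
proof -
  interpret nonarchimedean_disc v r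
    by (intro nonarchimedean_disc.intro nonarchimedean_disc_axioms.intro
        finite_extension_padic.nonarchimedean[OF K] r)
  have A: "nc_linear A = nc_diag lam" by (simp add: A_diagonal nc_linear_diag)
  have "fhat i \<in> aug_ideal_power v r 2" for i
    using fhat by (simp add: eq_upto_O_def)
  then have f_agree: "nc_agree 1 (f i) (nc_diag lam i)" for i
    unfolding aug_ideal_power_iff by (simp add: nc_agree_def f_eq A)
  \<comment> \<open>Chosen so that divisors in degrees up to \<open>2 * 2 ^ s\<close> are at least
    \<open>exp (- (\<alpha> * s + \<beta>))\<close>, the reciprocal of
    \<open>a s ^ (2 ^ s)\<close>.\<close>
  define \<alpha> \<beta> where "\<alpha> = \<mu> * ln 2" and "\<beta> = \<bar>ln c\<bar>"
  have \<alpha>: "\<alpha> > 0" and \<beta>: "\<beta> \<ge> 0" using siegel by (simp_all add: \<alpha>_def \<beta>_def)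
  define a where "a = (\<lambda>s :: nat. exp ((\<alpha> * s + \<beta>) / 2 ^ s))"
  \<comment> \<open>Closed form of \<open>1 / r\<close> times the product of the \<open>a t\<close>
    for \<open>t < s\<close>: the exponents (\<alpha> t + \<beta>) / 2^t sum to 2(\<alpha> +
    \<beta>) in total, and the subtracted term is their tail from \<open>s\<close> on.
    \<open>D\<close> is the limit.\<close>
  define C where "C = (\<lambda>s :: nat. 1 / r * exp (2 * (\<alpha> + \<beta>) - (2 * \<alpha> * (s + 1) + 2 * \<beta>) / 2 ^ s))"
  define D where "D = 1 / r * exp (2 * (\<alpha> + \<beta>))"
  have nonres: "1 \<le> v (word_eval lam w - lam i) * a s ^ (2 ^ s)"
    if w: "2 ^ s < length w" "length w \<le> 2 * 2 ^ s" "word_eval lam w \<noteq> lam i" for s i w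
  proof -
    have len: "real (length w) / 2 \<le> 2 ^ s" "0 < length w"
      using w(2) of_nat_le_iff[of "length w" "2 * 2 ^ s", where 'a = real] w(1) by auto
    have "1 = c * exp (- ln c)" using siegel by (simp add: exp_minus)
    also have "\<dots> \<le> c * exp \<beta>" using siegel by (auto simp: \<beta>_def)
    also have "\<dots> = c * (2 ^ s) powr (- \<mu>) * exp (\<alpha> * s + \<beta>)"
      by (simp add: powr_def ln_realpow \<alpha>_def exp_add exp_minus field_simps)
    \<comment> \<open>\<open>length w / 2\<close> is at most \<open>2 ^ s\<close>, and a negative
      power is decreasing.\<close>
    also have "\<dots> \<le> c * (real (length w) / 2) powr (- \<mu>) * exp (\<alpha> * s + \<beta>)"
      using len siegel by (intro mult_right_mono mult_left_mono powr_mono2') auto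
    also have "\<dots> \<le> v (word_eval lam w - lam i) * exp (\<alpha> * s + \<beta>)"
      using siegel_word_eval[OF siegel(3) _ w(3)] len by (intro mult_right_mono) auto
    also have "exp (\<alpha> * s + \<beta>) = a s ^ (2 ^ s)"
      by (simp add: a_def flip: exp_of_nat_mult)
    finally show ?thesis .
  qed
  have C_Suc: "C (Suc s) = C s * a s" for s
    by (simp add: C_def a_def mult.assoc flip: exp_add) (simp add: field_simps)
  have C_le: "C s \<le> D" for s
    using \<alpha> \<beta> r by (simp add: C_def D_def divide_right_mono)
  have "tuple_bound (C 0) f" using tuple_bound_End_op[OF f] by (simp add: C_def)
  moreover have "C 0 > 0" using r by (simp add: C_def)
  moreover have "a s \<ge> 1" for s using \<alpha> \<beta> by (simp add: a_def)
  ultimately obtain \<psi> where \<psi>: "unipotent \<psi>" "tuple_bound D \<psi>" "f \<circ>\<^sub>n\<^sub>c \<psi> = \<psi> \<circ>\<^sub>n\<^sub>c nc_diag lam"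
    using newton_limit[OF semisimple_kernel[OF semisimple f] _ f_agree _ C_Suc C_le _ nonres] by blast
  have D: "D \<ge> 1 / r" "D > 0" using \<alpha> \<beta> r by (simp_all add: D_def divide_right_mono)
  have pf: "pointed f" using f by (auto simp: End_op_def aug_ideal_def pointed_def)
  note p = unipotent_pointed[OF \<psi>(1)]
  have "left_inverse \<psi> \<circ>\<^sub>n\<^sub>c f \<circ>\<^sub>n\<^sub>c \<psi> = (left_inverse \<psi> \<circ>\<^sub>n\<^sub>c \<psi>) \<circ>\<^sub>n\<^sub>c nc_diag lam"
    by (simp add: nc_comp_assoc pf p \<psi>(3))
  then have conj: "left_inverse \<psi> \<circ>\<^sub>n\<^sub>c f \<circ>\<^sub>n\<^sub>c \<psi> = nc_linear A"
    by (simp add: left_inverse_comp[OF \<psi>(1)] A)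
  have "inverse_in_End_op v (1 / (2 * D)) \<psi> (left_inverse \<psi>)"
    unfolding inverse_in_End_op_def
    using tuple_bound_in_End_op[OF \<psi>(2) D(2)]
      tuple_bound_in_End_op[OF tuple_bound_left_inverse[OF \<psi>(2) D(2)] D(2)]
      left_inverse_comp[OF \<psi>(1)] comp_left_inverse[OF \<psi>(1)] by blast
  \<comment> \<open>From \<open>D \<ge> 1 / r\<close> the new radius is at most
    \<open>r / 2\<close>.\<close>
  moreover have "1 / (2 * D) < r"
  proof -
    have "1 \<le> D * r" using D(1) r by (simp add: field_simps)
    then show ?thesis using D(2) by (simp add: field_simps)
  qed
  ultimately show ?thesis using conj D(2)
    by (intro exI[of _ "1 / (2 * D)"] exI[of _ \<psi>] exI[of _ "left_inverse \<psi>"]) simp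
qed

end
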